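(* Let $E,F$ be locally convex spaces, $U\subseteq E$ open, and $f:U\to F$ a function with $f(U^*\cap E_f)\subseteq F_f$. Suppose $f$ is uniformly differentiable at finite points. Then the induced map $\hat f:\hat U\to\hat F$ is $C^1$.
   Context: We work in a sufficiently saturated nonstandard extension; $A^*$ is the nonstandard extension of $A$, and the extension of a function is denoted by the same symbol. A locally convex space is a real Hausdorff topological vector space with a base of convex neighborhoods of $0$. For a locally convex space $E$: $E_f=\{x\in E^* : p(x)$ is a finite hyperreal for all continuous seminorms $p$ on $E\}$; $\mu(E)=\{x\in E^* : p(x)$ is infinitesimal for all continuous seminorms $p\}$; $a\sim b$ means $a-b\in\mu(E)$; $\mu(a)=a+\mu(E)$; $\operatorname{int}(U^* )=\{a\in U^* : \mu(a)\subseteq U^*\}$. $\operatorname{Lin}(E,F)$ is the space of linear maps, and $\operatorname{FLin}(E^*,F^* )$ is the space of internal linear maps $T:E^*\to F^*$ with $T(E_f)\subseteq F_f$. The nonstandard hull of $E$ is $\hat E=E_f/\mu(E)$ with the locally convex topology given by the seminorms $\hat p(x+\mu(E))=\operatorname{st}(p(x))$, $p$ ranging over the continuous seminorms of $E$; write $[\![x]\!]=x+\mu(E)$. $f$ is uniformly differentiable at finite points if there is a map $df:U\to\operatorname{Lin}(E,F)$ such that for every $a\in\operatorname{int}(U^* )\cap E_f$ one has $df(a)\in\operatorname{FLin}(E^*,F^* )$ and, for every $h\in E_f$ and every positive infinitesimal $\delta$, $\frac1\delta(f(a+\delta h)-f(a))\sim df(a)(h)$. Fix a representation $U=\bigcup_{i\in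 I}\bigcap_{j=1}^{n_i}\{x\in E : p_{ij}(x-x_{ij})<\epsilon_{ij}\}$ with $p_{ij}$ continuous seminorms on $E$, $x_{ij}\in E$, $\epsilon_{ij}\in\mathbb R^{>0}$, and put $\hat U=\bigcup_{i\in I}\bigcap_{j=1}^{n_i}\{[\![x]\!]\in\hat E : \hat p_{ij}([\![x]\!]-[\![x_{ij}]\!])<\epsilon_{ij}\}$, an open subset of $\hat E$; $[\![x]\!]\in\hat U$ implies $x\in\operatorname{int}(U^* )\cap E_f$. When $f(U^*\cap E_f)\subseteq F_f$ and $f$ is uniformly differentiable at finite points, $f(w)\sim f(z)$ whenever $w\in\operatorname{int}(U^* )\cap E_f$ and $z\sim w$, so $\hat f:\hat U\to\hat F$, $\hat f([\![a]\!])=[\![f(a)]\!]$, is well defined. A map $g:O\to F'$ from an open subset $O$ of a locally convex space $E'$ to a locally convex space $F'$ is $C^1$ if $dg(a)(h)=\lim_{t\to0}\frac1t(g(a+th)-g(a))$ exists for all $a\in O$, $h\in E'$, and $dg:O\times E'\to F'$ is continuous. *)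

theory Defs
  imports "HOL-Analysis.Analysis"
begin

section \<open>Nonstandard extensions\<close>

text \<open>
  A nonstandard extension is presented as a limit ultrapower: an index type carries an
  ultrafilter and an arbitrary filter on pairs of indices; the internal points of the extension of
  a type are the sequences whose kernel \<open>{(i, j). x i = x j}\<close> belongs to the second filter, up to
  equality almost everywhere for the ultrafilter. By a theorem of Keisler every nonstandard
  extension (i.e. every elementary extension for the language with all relations and functions)
  is isomorphic to one of this form; ordinary ultrapowers are the case \<open>kernels = bot\<close>. Both
  filters are class parameters of the index type, so a theorem that is polymorphic in
  the index type is a theorem about all nonstandard extensions.
\<close>

class nonstandard_index =
  fixes ultra :: "'a filter"
    and kernels :: "('a \<times> 'a) filter"
  assumes ultra_neq_bot: "ultra \<noteq> bot"
    and ultra_dichotomy: "eventually P ultra \<or> eventually (\<lambda>i. \<not> P i) ultra"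

definition admissible :: "('i::nonstandard_index \<Rightarrow> 'a) \<Rightarrow> bool" where
  "admissible x \<longleftrightarrow> (\<forall>\<^sub>F (i, j) in kernels. x i = x j)"

definition star_rel :: "('i::nonstandard_index \<Rightarrow> 'a) \<Rightarrow> ('i \<Rightarrow> 'a) \<Rightarrow> bool" where
  "star_rel x y \<longleftrightarrow> admissible x \<and> admissible y \<and> (\<forall>\<^sub>F i in ultra. x i = y i)"

lemma admissible_const [simp]: "admissible (\<lambda>i. a)"
  by (simp add: admissible_def case_prod_unfold)

lemma admissible_app:
  assumes "admissible f" "admissible x"
  shows "admissible (\<lambda>i. f i (x i))"
  using assms unfolding admissible_def
  by (auto elim: eventually_elim2 simp: case_prod_unfold)

lemma admissible_map: "admissible x \<Longrightarrow> admissible (\<lambda>i. f (x i))"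
  by (rule admissible_app) simp_all

lemma admissible_map2:
  "admissible x \<Longrightarrow> admissible y \<Longrightarrow> admissible (\<lambda>i. f (x i) (y i))"
  by (rule admissible_app [OF admissible_map])

quotient_type (overloaded) ('i, 'a) star = "'i::nonstandard_index \<Rightarrow> 'a" / partial: star_rel
  morphisms rep_star mk_star
proof (rule part_equivpI)
  show "\<exists>x :: 'i \<Rightarrow> 'a. star_rel x x"
    by (rule exI [of _ "\<lambda>i. undefined"]) (simp add: star_rel_def)
  show "symp (star_rel :: ('i \<Rightarrow> 'a) \<Rightarrow> _)"
    by (auto simp: symp_def star_rel_def eq_commute)
  show "transp (star_rel :: ('i \<Rightarrow> 'a) \<Rightarrow> _)"
    by (auto simp: transp_def star_rel_def elim: eventually_elim2)
qed

lift_definition star_of :: "'a \<Rightarrow> ('i::nonstandard_index, 'a) star" is "\<lambda>a i. a"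
  by (simp add: star_rel_def)

text \<open>Elements of \<open>('i, 'a \<Rightarrow> 'b) star\<close> are the internal functions, elements of
  \<open>('i, 'a set) star\<close> the internal sets.\<close>

lift_definition star_app ::
  "('i::nonstandard_index, 'a \<Rightarrow> 'b) star \<Rightarrow> ('i, 'a) star \<Rightarrow> ('i, 'b) star" (infixl \<open>$*\<close> 200)
  is "\<lambda>T x i. T i (x i)"
  by (auto simp: star_rel_def intro: admissible_app elim: eventually_elim2)

lift_definition star_true :: "('i::nonstandard_index, bool) star \<Rightarrow> bool"
  is "\<lambda>P. eventually P ultra"
  by (auto simp: star_rel_def elim: eventually_elim2)

definition star_map :: "('a \<Rightarrow> 'b) \<Rightarrow> ('i::nonstandard_index, 'a) star \<Rightarrow> ('i, 'b) star" where
  "star_map f x = star_of f $* x"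

definition star_map2 ::
  "('a \<Rightarrow> 'b \<Rightarrow> 'c) \<Rightarrow> ('i::nonstandard_index, 'a) star \<Rightarrow> ('i, 'b) star \<Rightarrow> ('i, 'c) star" where
  "star_map2 f x y = star_of f $* x $* y"

definition star_mem :: "('i::nonstandard_index, 'a) star \<Rightarrow> ('i, 'a set) star \<Rightarrow> bool" where
  "star_mem x A \<longleftrightarrow> star_true (star_map2 (\<in>) x A)"

definition star_set :: "'a set \<Rightarrow> ('i::nonstandard_index, 'a) star set" where
  "star_set A = {x. star_mem x (star_of A)}"

text \<open>Every family of internal sets of points of \<open>'a\<close>, indexed by \<open>'k\<close>, with the finite
  intersection property has a common point.\<close>

definition saturated :: "'k itself \<Rightarrow> ('i::nonstandard_index, 'a) star itself \<Rightarrow> bool" where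
  "saturated _ _ \<longleftrightarrow>
    (\<forall>A :: 'k \<Rightarrow> ('i, 'a set) star.
      (\<forall>K. finite K \<longrightarrow> (\<exists>x. \<forall>k\<in>K. star_mem x (A k))) \<longrightarrow> (\<exists>x. \<forall>k. star_mem x (A k)))"

subsection \<open>Representatives\<close>

lemma star_cases [case_names mk, cases type: star]:
  obtains x where "admissible x" "X = mk_star x"
proof -
  have "star_rel (rep_star X) (rep_star X)"
    by (rule Quotient_rep_reflp [OF Quotient_star])
  then have "admissible (rep_star X)" by (simp add: star_rel_def)
  moreover have "X = mk_star (rep_star X)"
    using Quotient_abs_rep [OF Quotient_star, of X] by simp
  ultimately show ?thesis by (rule that)
qed

lemma mk_star_eq_iff:
  "admissible x \<Longrightarrow> admissible y \<Longrightarrow> mk_star x = mk_star y \<longleftrightarrow> (\<forall>\<^sub>F i in ultra. x i = y i)"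
  using Quotient_rel [OF Quotient_star, of x y] by (auto simp: star_rel_def)

lemma star_of_mk: "star_of a = mk_star (\<lambda>i. a)"
  by (simp add: star_of.abs_eq)

lemma star_app_mk:
  "admissible f \<Longrightarrow> admissible x \<Longrightarrow> mk_star f $* mk_star x = mk_star (\<lambda>i. f i (x i))"
  by (rule star_app.abs_eq) (auto simp: star_rel_def)

lemma star_true_mk: "admissible P \<Longrightarrow> star_true (mk_star P) \<longleftrightarrow> eventually P ultra"
  by (rule star_true.abs_eq) (auto simp: star_rel_def)

lemma star_map_mk: "admissible x \<Longrightarrow> star_map f (mk_star x) = mk_star (\<lambda>i. f (x i))"
  by (simp add: star_map_def star_of_mk star_app_mk)

lemma star_map2_mk:
  "admissible x \<Longrightarrow> admissible y \<Longrightarrow>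
    star_map2 f (mk_star x) (mk_star y) = mk_star (\<lambda>i. f (x i) (y i))"
  unfolding star_map2_def star_of_mk
  by (subst star_app_mk, (simp; fail), assumption)
    (rule star_app_mk [OF admissible_map])

lemma star_mem_mk:
  "admissible x \<Longrightarrow> admissible A \<Longrightarrow>
    star_mem (mk_star x) (mk_star A) \<longleftrightarrow> (\<forall>\<^sub>F i in ultra. x i \<in> A i)"
  unfolding star_mem_def by (subst star_map2_mk) (simp_all add: star_true_mk admissible_map2)

lemma star_set_mk: "admissible x \<Longrightarrow> mk_star x \<in> star_set A \<longleftrightarrow> (\<forall>\<^sub>F i in ultra. x i \<in> A)"
  by (simp add: star_set_def star_of_mk star_mem_mk)

lemma not_eventually_ultra:
  "\<not> eventually P (ultra :: 'i::nonstandard_index filter) \<longleftrightarrow> eventually (\<lambda>i. \<not> P i) ultra"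
proof
  assume n: "eventually (\<lambda>i. \<not> P i) (ultra :: 'i filter)"
  show "\<not> eventually P (ultra :: 'i filter)"
  proof
    assume "eventually P (ultra :: 'i filter)"
    with n have "eventually (\<lambda>i. False) (ultra :: 'i filter)"
      by eventually_elim simp
    then show False by (simp add: ultra_neq_bot)
  qed
qed (use ultra_dichotomy in blast)

subsection \<open>Algebraic operations\<close>

lemma admissible_plus [simp]:
  "admissible x \<Longrightarrow> admissible y \<Longrightarrow> admissible (\<lambda>i. x i + y i)"
  by (rule admissible_map2)

lemma admissible_minus [simp]:
  "admissible x \<Longrightarrow> admissible y \<Longrightarrow> admissible (\<lambda>i. x i - y i)"
  by (rule admissible_map2)

lemma admissible_uminus [simp]:
  "admissible x \<Longrightarrow> admissible (\<lambda>i. - x i)"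
  by (rule admissible_map)

lemma admissible_times [simp]:
  "admissible x \<Longrightarrow> admissible y \<Longrightarrow> admissible (\<lambda>i. x i * y i)"
  by (rule admissible_map2)

lemma admissible_divide [simp]:
  "admissible x \<Longrightarrow> admissible y \<Longrightarrow> admissible (\<lambda>i. x i div y i)"
  by (rule admissible_map2)

lemma admissible_inverse [simp]:
  "admissible x \<Longrightarrow> admissible (\<lambda>i. inverse (x i))"
  by (rule admissible_map)

lemma admissible_abs [simp]:
  "admissible x \<Longrightarrow> admissible (\<lambda>i. \<bar>x i\<bar>)"
  by (rule admissible_map)

lemma admissible_sgn [simp]:
  "admissible x \<Longrightarrow> admissible (\<lambda>i. sgn (x i))"
  by (rule admissible_map)

lemma admissible_scaleR [simp]:
  "admissible r \<Longrightarrow> admissible x \<Longrightarrow> admissible (\<lambda>i. r i *\<^sub>R x i)"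
  by (rule admissible_map2)

lemma admissible_le [simp]:
  "admissible x \<Longrightarrow> admissible y \<Longrightarrow> admissible (\<lambda>i. x i \<le> y i)"
  by (rule admissible_map2)

lemma admissible_less [simp]:
  "admissible x \<Longrightarrow> admissible y \<Longrightarrow> admissible (\<lambda>i. x i < y i)"
  by (rule admissible_map2)

instantiation star :: (nonstandard_index, ab_group_add) ab_group_add
begin

definition "0 = star_of 0"
definition "x + y = star_map2 (+) x y"
definition "x - y = star_map2 (-) x y"
definition "- x = star_map uminus x"

lemma zero_mk: "0 = mk_star (\<lambda>i. 0)"
  by (simp add: zero_star_def star_of_mk)

lemma plus_mk:
  "admissible x \<Longrightarrow> admissible y \<Longrightarrow> mk_star x + mk_star y = mk_star (\<lambda>i. x i + y i)"
  by (simp add: plus_star_def star_map2_mk)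

lemma minus_mk:
  "admissible x \<Longrightarrow> admissible y \<Longrightarrow> mk_star x - mk_star y = mk_star (\<lambda>i. x i - y i)"
  by (simp add: minus_star_def star_map2_mk)

lemma uminus_mk: "admissible x \<Longrightarrow> - mk_star x = mk_star (\<lambda>i. - x i)"
  by (simp add: uminus_star_def star_map_mk)

lemmas group_mk = zero_mk plus_mk minus_mk uminus_mk

instance
proof
  fix a b c :: "('a, 'b) star"
  show "a + b + c = a + (b + c)"
    by (cases a; cases b; cases c) (simp add: group_mk add.assoc)
  show "a + b = b + a"
    by (cases a; cases b) (simp add: group_mk add.commute)
  show "0 + a = a"
    by (cases a) (simp add: group_mk)
  show "- a + a = 0"
    by (cases a) (simp add: group_mk)
  show "a - b = a + - b"
    by (cases a; cases b) (simp add: group_mk)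
qed

end

instantiation star :: (nonstandard_index, real_vector) real_vector
begin

definition "r *\<^sub>R x = star_map (scaleR r) x"

lemma scaleR_mk: "admissible x \<Longrightarrow> r *\<^sub>R mk_star x = mk_star (\<lambda>i. r *\<^sub>R x i)"
  by (simp add: scaleR_star_def star_map_mk)

instance
proof
  fix a b :: real and x y :: "('a, 'b) star"
  show "a *\<^sub>R (x + y) = a *\<^sub>R x + a *\<^sub>R y"
    by (cases x; cases y) (simp add: group_mk scaleR_mk scaleR_add_right)
  show "(a + b) *\<^sub>R x = a *\<^sub>R x + b *\<^sub>R x"
    by (cases x) (simp add: group_mk scaleR_mk scaleR_add_left)
  show "a *\<^sub>R b *\<^sub>R x = (a * b) *\<^sub>R x"
    by (cases x) (simp add: scaleR_mk)
  show "1 *\<^sub>R x = x"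
    by (cases x) (simp add: scaleR_mk)
qed

end

instantiation star :: (nonstandard_index, linordered_field) linordered_field
begin

definition "1 = star_of 1"
definition "x * y = star_map2 (*) x y"
definition "x div y = star_map2 (/) x y"
definition "inverse x = star_map inverse x"
definition abs_hyper_def: "\<bar>x\<bar> = star_map abs x"
definition "sgn x = star_map sgn x"
definition "x \<le> y \<longleftrightarrow> star_true (star_map2 (\<le>) x y)"
definition "x < y \<longleftrightarrow> star_true (star_map2 (<) x y)"

lemma one_mk: "1 = mk_star (\<lambda>i. 1)"
  by (simp add: one_star_def star_of_mk)

lemma times_mk:
  "admissible x \<Longrightarrow> admissible y \<Longrightarrow> mk_star x * mk_star y = mk_star (\<lambda>i. x i * y i)"
  by (simp add: times_star_def star_map2_mk)

lemma divide_mk: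
  "admissible x \<Longrightarrow> admissible y \<Longrightarrow> mk_star x div mk_star y = mk_star (\<lambda>i. x i / y i)"
  by (simp add: divide_star_def star_map2_mk)

lemma inverse_mk: "admissible x \<Longrightarrow> inverse (mk_star x) = mk_star (\<lambda>i. inverse (x i))"
  by (simp add: inverse_star_def star_map_mk)

lemma abs_mk: "admissible x \<Longrightarrow> \<bar>mk_star x\<bar> = mk_star (\<lambda>i. \<bar>x i\<bar>)"
  by (simp add: abs_hyper_def star_map_mk)

lemma sgn_mk: "admissible x \<Longrightarrow> sgn (mk_star x) = mk_star (\<lambda>i. sgn (x i))"
  by (simp add: sgn_star_def star_map_mk)

lemma le_mk:
  "admissible x \<Longrightarrow> admissible y \<Longrightarrow> mk_star x \<le> mk_star y \<longleftrightarrow> (\<forall>\<^sub>F i in ultra. x i \<le> y i)"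
  by (simp add: less_eq_star_def star_map2_mk star_true_mk)

lemma less_mk:
  "admissible x \<Longrightarrow> admissible y \<Longrightarrow> mk_star x < mk_star y \<longleftrightarrow> (\<forall>\<^sub>F i in ultra. x i < y i)"
  by (simp add: less_star_def star_map2_mk star_true_mk)

lemmas field_mk = one_mk times_mk divide_mk inverse_mk abs_mk sgn_mk le_mk less_mk

instance
proof
  fix a b c :: "('a, 'b) star"
  show "a * b * c = a * (b * c)"
    by (cases a; cases b; cases c) (simp add: field_mk mult.assoc)
  show "a * b = b * a"
    by (cases a; cases b) (simp add: field_mk mult.commute)
  show "1 * a = a"
    by (cases a) (simp add: field_mk)
  show "(a + b) * c = a * c + b * c"
    by (cases a; cases b; cases c) (simp add: group_mk field_mk distrib_right)
  show "0 * a = 0" "a * 0 = 0"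
    by (cases a; simp add: group_mk field_mk)+
  show "(0::('a, 'b) star) \<noteq> 1"
    by (simp add: group_mk field_mk mk_star_eq_iff ultra_neq_bot)
  show "inverse a * a = 1" if "a \<noteq> 0"
    using that
    by (cases a) (auto simp: group_mk field_mk mk_star_eq_iff not_eventually_ultra
        elim: eventually_mono)
  show "a div b = a * inverse b"
    by (cases a; cases b) (simp add: field_mk divide_inverse)
  show "inverse (0::('a, 'b) star) = 0"
    by (simp add: group_mk field_mk)
  show less: "a < b \<longleftrightarrow> a \<le> b \<and> \<not> b \<le> a" for a b :: "('a, 'b) star"
  proof (cases a; cases b)
    fix x y :: "'a \<Rightarrow> 'b"
    assume xy: "admissible x" "a = mk_star x" "admissible y" "b = mk_star y"
    have "(\<forall>\<^sub>F i in ultra. x i < y i) \<longleftrightarrow>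
      (\<forall>\<^sub>F i in ultra. x i \<le> y i) \<and> (\<forall>\<^sub>F i in ultra. \<not> y i \<le> x i)"
      unfolding eventually_conj_iff [symmetric] by (simp add: less_le_not_le)
    with xy show "a < b \<longleftrightarrow> a \<le> b \<and> \<not> b \<le> a"
      by (simp add: field_mk not_eventually_ultra)
  qed
  show "a \<le> a"
    by (cases a) (simp add: field_mk)
  show "a \<le> c" if "a \<le> b" "b \<le> c"
    using that by (cases a; cases b; cases c) (simp add: field_mk, erule (1) eventually_elim2, simp)
  show "a = b" if "a \<le> b" "b \<le> a"
    using that
    by (cases a; cases b) (simp add: field_mk mk_star_eq_iff, erule (1) eventually_elim2, simp)
  show total: "a \<le> b \<or> b \<le> a" for a b :: "('a, 'b) star"
  proof (cases a; cases b)
    fix x y :: "'a \<Rightarrow> 'b"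
    assume xy: "admissible x" "a = mk_star x" "admissible y" "b = mk_star y"
    show "a \<le> b \<or> b \<le> a"
    proof (cases "\<forall>\<^sub>F i in ultra. x i \<le> y i")
      case False
      then have "\<forall>\<^sub>F i in ultra. y i \<le> x i"
        by (auto simp: not_eventually_ultra not_le elim: eventually_mono)
      with xy show ?thesis by (simp add: field_mk)
    qed (use xy in \<open>simp add: field_mk\<close>)
  qed
  show "c + a \<le> c + b" if "a \<le> b"
    using that by (cases a; cases b; cases c) (simp add: group_mk field_mk)
  show "c * a < c * b" if "a < b" "0 < c"
    using that
    by (cases a; cases b; cases c) (simp add: group_mk field_mk, erule (1) eventually_elim2, simp add: mult_strict_left_mono)
  show "\<bar>a\<bar> = (if a < 0 then - a else a)"
    by (cases a)
      (auto simp: group_mk field_mk mk_star_eq_iff not_eventually_ultra elim: eventually_mono)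
  show "sgn a = (if a = 0 then 0 else if 0 < a then 1 else - 1)"
  proof (cases a)
    case (mk x)
    consider "a = 0" | "0 < a" | "\<not> 0 < a" "a \<noteq> 0" by blast
    then show ?thesis
    proof cases
      case 3
      with mk have "\<forall>\<^sub>F i in ultra. \<not> 0 < x i" "\<forall>\<^sub>F i in ultra. x i \<noteq> 0"
        by (simp_all add: group_mk field_mk mk_star_eq_iff not_eventually_ultra)
      then have "\<forall>\<^sub>F i in ultra. sgn (x i) = - 1"
        by eventually_elim (simp add: sgn_if)
      with mk 3 show ?thesis by (simp add: group_mk field_mk mk_star_eq_iff)
    qed (use mk in \<open>auto simp: group_mk field_mk mk_star_eq_iff elim: eventually_mono\<close>)
  qed
qed

end


section \<open>Finite and infinitesimal hyperreals\<close>

definition hfinite :: "('i::nonstandard_index, real) star \<Rightarrow> bool" where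
  "hfinite x \<longleftrightarrow> (\<exists>r. \<bar>x\<bar> \<le> star_of r)"

definition infinitesimal :: "('i::nonstandard_index, real) star \<Rightarrow> bool" where
  "infinitesimal x \<longleftrightarrow> (\<forall>r>0. \<bar>x\<bar> < star_of r)"

definition st :: "('i::nonstandard_index, real) star \<Rightarrow> real" where
  "st x = (THE r. infinitesimal (x - star_of r))"

lemma star_of_plus: "star_of (a + b) = star_of a + star_of b"
  by (simp add: star_of_mk plus_mk)

lemma star_of_minus: "star_of (a - b) = star_of a - star_of b"
  by (simp add: star_of_mk minus_mk)

lemma star_of_times: "star_of (a * b) = star_of a * star_of b"
  by (simp add: star_of_mk times_mk)

lemma star_of_abs: "star_of \<bar>a\<bar> = \<bar>star_of a\<bar>"
  by (simp add: star_of_mk abs_mk)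

lemma star_of_zero: "star_of 0 = 0"
  by (simp add: star_of_mk zero_mk)

lemma star_of_le [simp]: "star_of a \<le> star_of b \<longleftrightarrow> a \<le> b"
  by (simp add: star_of_mk le_mk ultra_neq_bot)

lemma star_of_less [simp]: "star_of a < star_of b \<longleftrightarrow> a < b"
  by (simp add: star_of_mk less_mk ultra_neq_bot)

lemma star_of_0_less [simp]: "0 < star_of b \<longleftrightarrow> 0 < b"
  using star_of_less [of 0 b] by (simp add: star_of_zero)

lemma star_of_0_le [simp]: "0 \<le> star_of b \<longleftrightarrow> 0 \<le> b"
  using star_of_le [of 0 b] by (simp add: star_of_zero)

lemma infinitesimal_0 [simp]: "infinitesimal 0"
  by (simp add: infinitesimal_def)

lemma infinitesimal_add:
  assumes "infinitesimal x" "infinitesimal y"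
  shows "infinitesimal (x + y)"
  unfolding infinitesimal_def
proof (intro allI impI)
  fix r :: real assume "r > 0"
  then have "\<bar>x\<bar> < star_of (r / 2)" "\<bar>y\<bar> < star_of (r / 2)"
    using assms by (auto simp: infinitesimal_def)
  then have "\<bar>x + y\<bar> < star_of (r / 2) + star_of (r / 2)"
    by linarith
  also have "\<dots> = star_of r"
    by (simp flip: star_of_plus)
  finally show "\<bar>x + y\<bar> < star_of r" .
qed

lemma infinitesimal_minus: "infinitesimal x \<Longrightarrow> infinitesimal (- x)"
  by (simp add: infinitesimal_def)

lemma infinitesimal_diff: "infinitesimal x \<Longrightarrow> infinitesimal y \<Longrightarrow> infinitesimal (x - y)"
  using infinitesimal_add [OF _ infinitesimal_minus, of x y] by simp

lemma infinitesimal_mono: "infinitesimal y \<Longrightarrow> \<bar>x\<bar> \<le> \<bar>y\<bar> \<Longrightarrow> infinitesimal x"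
  by (auto simp: infinitesimal_def intro: le_less_trans)

lemma infinitesimal_scale: 
  assumes "infinitesimal x" shows "infinitesimal (star_of c * x)"
proof -
  have *: "infinitesimal (star_of d * x)" if d: "d > 0" for d
    unfolding infinitesimal_def
  proof (intro allI impI)
    fix r :: real assume "r > 0"
    with d assms have "\<bar>x\<bar> < star_of (r / d)"
      by (auto simp: infinitesimal_def)
    then have "star_of d * \<bar>x\<bar> < star_of d * star_of (r / d)"
      using d by (intro mult_strict_left_mono) auto
    then show "\<bar>star_of d * x\<bar> < star_of r"
      using d by (simp add: abs_mult flip: star_of_times star_of_abs)
  qed
  show ?thesis
    by (rule infinitesimal_mono [OF * [of "\<bar>c\<bar> + 1"]])
      (auto simp: abs_mult simp flip: star_of_abs intro: mult_right_mono)
qed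

lemma infinitesimal_star_of [simp]: "infinitesimal (star_of r) \<longleftrightarrow> r = 0"
proof
  assume "infinitesimal (star_of r :: ('a, real) star)"
  then have "\<forall>s>0. \<bar>r\<bar> < s"
    by (simp add: infinitesimal_def flip: star_of_abs)
  then have "\<not> \<bar>r\<bar> > 0" by blast
  then show "r = 0" by simp
qed (simp add: star_of_zero)

lemma hfinite_add:
  assumes "hfinite x" "hfinite y"
  shows "hfinite (x + y)"
proof -
  from assms obtain r s where "\<bar>x\<bar> \<le> star_of r" "\<bar>y\<bar> \<le> star_of s"
    by (auto simp: hfinite_def)
  then have "\<bar>x + y\<bar> \<le> star_of (r + s)"
    unfolding star_of_plus by linarith
  then show ?thesis by (auto simp: hfinite_def)
qed

lemma hfinite_mono: "hfinite y \<Longrightarrow> \<bar>x\<bar> \<le> \<bar>y\<bar> \<Longrightarrow> hfinite x"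
  by (auto simp: hfinite_def intro: order_trans)

lemma hfinite_scale:
  assumes "hfinite x" shows "hfinite (star_of c * x)"
proof -
  from assms obtain r where "\<bar>x\<bar> \<le> star_of r" by (auto simp: hfinite_def)
  then have "\<bar>star_of c * x\<bar> \<le> star_of (\<bar>c\<bar> * r)"
    by (auto simp: abs_mult star_of_times star_of_abs intro: mult_left_mono)
  then show ?thesis by (auto simp: hfinite_def)
qed

lemma infinitesimal_hfinite: "infinitesimal x \<Longrightarrow> hfinite x"
  by (auto simp: infinitesimal_def hfinite_def intro!: exI [of _ 1] less_imp_le)

lemma st_unique: "infinitesimal (x - star_of r) \<Longrightarrow> st x = r"
  unfolding st_def
proof (rule the_equality)
  fix s assume "infinitesimal (x - star_of r)" "infinitesimal (x - star_of s)"
  then have "infinitesimal ((x - star_of r) - (x - star_of s))"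
    by (rule infinitesimal_diff)
  then have "infinitesimal (star_of (s - r) :: ('a, real) star)"
    by (simp add: star_of_minus)
  then show "s = r" by simp
qed

lemma infinitesimal_st:
  assumes "hfinite x"
  shows "infinitesimal (x - star_of (st x))"
proof -
  define A where "A = {r. star_of r \<le> x}"
  from assms obtain b where b: "\<bar>x\<bar> \<le> star_of b" by (auto simp: hfinite_def)
  have ub: "r \<le> b" if "r \<in> A" for r
  proof -
    have "star_of r \<le> x" using that by (simp add: A_def)
    also have "x \<le> star_of b" using b by linarith
    finally show ?thesis by simp
  qed
  then have bdd: "bdd_above A" by (auto simp: bdd_above_def)
  have "star_of (- b) = - (star_of b :: ('a, real) star)"
    using star_of_minus [of 0 b] by (simp add: star_of_zero)
  with b have "- b \<in> A" by (simp add: A_def)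
  then have ne: "A \<noteq> {}" by auto
  have "infinitesimal (x - star_of (Sup A))"
    unfolding infinitesimal_def
  proof (intro allI impI)
    fix r :: real assume r: "r > 0"
    then obtain s where "s \<in> A" "Sup A - r < s"
      using less_cSup_iff [OF ne bdd, of "Sup A - r"] by auto
    then have "star_of (Sup A - r) < x"
      by (auto simp: A_def intro: less_le_trans [of _ "star_of s"])
    moreover have "Sup A + r / 2 \<notin> A"
      using cSup_upper [OF _ bdd, of "Sup A + r / 2"] r by auto
    then have "x < star_of (Sup A + r / 2)" by (auto simp: A_def)
    then have "x < star_of (Sup A + r)"
      using r by (auto intro: less_trans [of _ "star_of (Sup A + r / 2)"])
    ultimately show "\<bar>x - star_of (Sup A)\<bar> < star_of r"
      by (simp add: star_of_minus star_of_plus abs_less_iff algebra_simps)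
  qed
  then show ?thesis using st_unique by metis
qed

lemma st_star_of [simp]: "st (star_of r) = r"
  by (rule st_unique) simp

lemma st_0 [simp]: "st 0 = 0"
  using st_star_of [of 0] by (simp add: star_of_zero)

lemma st_eq: 
  assumes "hfinite x" "infinitesimal (x - y)" shows "st x = st y"
proof (rule sym, rule st_unique)
  have "infinitesimal ((x - star_of (st x)) - (x - y))"
    by (intro infinitesimal_diff infinitesimal_st assms)
  then show "infinitesimal (y - star_of (st x))" by simp
qed

lemma st_add: "hfinite x \<Longrightarrow> hfinite y \<Longrightarrow> st (x + y) = st x + st y"
  by (rule st_unique, unfold star_of_plus add_diff_add)
    (intro infinitesimal_add infinitesimal_st)

lemma st_scale: "hfinite x \<Longrightarrow> st (star_of c * x) = c * st x"
  by (rule st_unique, unfold star_of_times right_diff_distrib [symmetric])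
    (intro infinitesimal_scale infinitesimal_st)

lemma st_mono:
  assumes "hfinite x" "hfinite y" "x \<le> y" shows "st x \<le> st y"
proof (rule ccontr)
  assume "\<not> st x \<le> st y"
  then have d: "st x - st y > 0" (is "?d > 0") by simp
  have "infinitesimal ((x - star_of (st x)) - (y - star_of (st y)))"
    by (intro infinitesimal_diff infinitesimal_st assms)
  then have "\<bar>(x - star_of (st x)) - (y - star_of (st y))\<bar> < star_of ?d"
    using d by (auto simp: infinitesimal_def)
  with assms(3) show False
    unfolding star_of_minus by linarith
qed

lemma st_eq_0_iff:
  assumes "hfinite x" shows "st x = 0 \<longleftrightarrow> infinitesimal x"
  using infinitesimal_st [OF assms] st_unique [of x 0] by (auto simp: star_of_zero)


section \<open>Locally convex spaces\<close>

text \<open>The last axiom spells out \<^const>\<open>convex\<close> and \<^const>\<open>interior\<close>, which cannot be used inside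
  a class specification; see \<open>convex_base\<close> below.\<close>

class locally_convex_space = topological_ab_group_add + real_vector + t2_space +
  assumes tendsto_scaleR_nhds: "filterlim (\<lambda>(r, x). r *\<^sub>R x) (nhds (c *\<^sub>R a)) (nhds (c::real) \<times>\<^sub>F nhds a)"
    and convex_base_unfolded: "open S \<Longrightarrow> 0 \<in> S \<Longrightarrow>
      \<exists>V W. (\<forall>x\<in>V. \<forall>y\<in>V. \<forall>u\<ge>0. \<forall>v\<ge>0. u + v = (1::real) \<longrightarrow> u *\<^sub>R x + v *\<^sub>R y \<in> V) \<and>
        open W \<and> 0 \<in> W \<and> W \<subseteq> V \<and> V \<subseteq> S"

lemma convex_base:
  fixes S :: "'e::locally_convex_space set"
  assumes "open S" "0 \<in> S"
  shows "\<exists>V. convex V \<and> 0 \<in> interior V \<and> V \<subseteq> S"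
  using convex_base_unfolded [OF assms] unfolding convex_def starlike_def interior_def by blast

definition continuous_seminorm :: "('e::locally_convex_space \<Rightarrow> real) \<Rightarrow> bool" where
  "continuous_seminorm p \<longleftrightarrow>
    (\<forall>x y. p (x + y) \<le> p x + p y) \<and> (\<forall>c x. p (c *\<^sub>R x) = \<bar>c\<bar> * p x) \<and> continuous_on UNIV p"

definition finite_points :: "('i::nonstandard_index, 'e::locally_convex_space) star set" where
  "finite_points = {x. \<forall>p. continuous_seminorm p \<longrightarrow> hfinite (star_map p x)}"

definition monad_zero :: "('i::nonstandard_index, 'e::locally_convex_space) star set" where
  "monad_zero = {x. \<forall>p. continuous_seminorm p \<longrightarrow> infinitesimal (star_map p x)}"

definition inf_close ::
  "('i::nonstandard_index, 'e::locally_convex_space) star \<Rightarrow> ('i, 'e) star \<Rightarrow> bool"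
  (infix \<open>\<sim>\<^sub>*\<close> 50) where
  "x \<sim>\<^sub>* y \<longleftrightarrow> x - y \<in> monad_zero"

definition monad :: 
  "('i::nonstandard_index, 'e::locally_convex_space) star \<Rightarrow> ('i, 'e) star set" where
  "monad a = (\<lambda>z. a + z) ` monad_zero"

definition star_interior :: "'e set \<Rightarrow> ('i::nonstandard_index, 'e::locally_convex_space) star set" where
  "star_interior U = {a \<in> star_set U. monad a \<subseteq> star_set U}"


subsection \<open>Calculus of continuous seminorms\<close>

lemma continuous_seminormD:
  assumes "continuous_seminorm p"
  shows "p (x + y) \<le> p x + p y" "p (c *\<^sub>R x) = \<bar>c\<bar> * p x" "continuous_on UNIV p" 
    "p 0 = 0" "p (- x) = p x" "p x \<ge> 0"
proof -
  show *: "p (x + y) \<le> p x + p y" "p (c *\<^sub>R x) = \<bar>c\<bar> * p x" "continuous_on UNIV p" for x y c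
    using assms by (auto simp: continuous_seminorm_def)
  show z: "p 0 = 0" using *(2) [of 0 0] by simp
  show m: "p (- x) = p x" using *(2) [of "- 1" x] by simp
  show "p x \<ge> 0" using *(1) [of x "- x"] by (simp add: z m)
qed

lemma continuous_seminorm_add:
  "continuous_seminorm p \<Longrightarrow> continuous_seminorm q \<Longrightarrow> continuous_seminorm (\<lambda>x. p x + q x)"
  unfolding continuous_seminorm_def
  by (auto intro: continuous_on_add simp: distrib_left) (smt (verit))

lemma continuous_seminorm_0: "continuous_seminorm (\<lambda>x. 0)"
  by (simp add: continuous_seminorm_def)

lemma star_seminorm_add:
  assumes "continuous_seminorm p"
  shows "star_map p (x + y) \<le> star_map p x + star_map p y"
  by (cases x; cases y)
    (simp add: plus_mk star_map_mk admissible_map [of _ p] le_mk continuous_seminormD(1) [OF assms])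

lemma star_seminorm_scaleR:
  assumes "continuous_seminorm p"
  shows "star_map p (c *\<^sub>R x) = star_of \<bar>c\<bar> * star_map p x"
  by (cases x)
    (simp add: scaleR_mk star_of_mk star_map_mk admissible_map [of _ p] times_mk
      admissible_map [of _ "scaleR c"]
      continuous_seminormD(2) [OF assms])

lemma star_seminorm_nonneg:
  assumes "continuous_seminorm p"
  shows "0 \<le> star_map p x"
  by (cases x)
    (simp add: zero_mk star_map_mk admissible_map [of _ p] le_mk continuous_seminormD(6) [OF assms])

lemma star_seminorm_minus:
  assumes "continuous_seminorm p"
  shows "star_map p (- x) = star_map p x"
  by (cases x)
    (simp add: uminus_mk star_map_mk continuous_seminormD(5) [OF assms])

lemma star_seminorm_zero:
  assumes "continuous_seminorm p"
  shows "star_map p 0 = 0"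
  by (simp add: zero_mk star_map_mk continuous_seminormD(4) [OF assms])

lemma finite_points_add:
  assumes "x \<in> finite_points" "y \<in> finite_points" shows "x + y \<in> finite_points"
  unfolding finite_points_def
proof (intro CollectI allI impI)
  fix p :: "'b \<Rightarrow> real" assume p: "continuous_seminorm p"
  then have "hfinite (star_map p x + star_map p y)"
    using assms by (intro hfinite_add) (auto simp: finite_points_def)
  then show "hfinite (star_map p (x + y))"
    by (rule hfinite_mono)
      (use star_seminorm_add [OF p, of x y] star_seminorm_nonneg [OF p, of "x + y"] in linarith)
qed

lemma finite_points_scaleR: "x \<in> finite_points \<Longrightarrow> c *\<^sub>R x \<in> finite_points"
  by (auto simp: finite_points_def star_seminorm_scaleR hfinite_scale)

lemma finite_points_zero [simp]: "0 \<in> finite_points"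
  by (auto simp: finite_points_def star_seminorm_zero infinitesimal_hfinite)

lemma finite_points_minus: "x \<in> finite_points \<Longrightarrow> - x \<in> finite_points"
  using finite_points_scaleR [of x "- 1"] by simp

lemma finite_points_diff: "x \<in> finite_points \<Longrightarrow> y \<in> finite_points \<Longrightarrow> x - y \<in> finite_points"
  using finite_points_add [OF _ finite_points_minus, of x y] by simp

lemma star_map_star_of: "star_map f (star_of a) = star_of (f a)"
  by (simp add: star_of_mk star_map_mk)

lemma hfinite_star_of [simp]: "hfinite (star_of r)"
  unfolding hfinite_def by (rule exI [of _ "\<bar>r\<bar>"]) (simp flip: star_of_abs)

lemma finite_points_star_of [simp]: "star_of a \<in> finite_points"
  by (simp add: finite_points_def star_map_star_of)

lemma monad_zero_add:
  assumes "x \<in> monad_zero" "y \<in> monad_zero" shows "x + y \<in> monad_zero"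
  unfolding monad_zero_def
proof (intro CollectI allI impI)
  fix p :: "'b \<Rightarrow> real" assume p: "continuous_seminorm p"
  then have "infinitesimal (star_map p x + star_map p y)"
    using assms by (intro infinitesimal_add) (auto simp: monad_zero_def)
  then show "infinitesimal (star_map p (x + y))"
    by (rule infinitesimal_mono)
      (use star_seminorm_add [OF p, of x y] star_seminorm_nonneg [OF p, of "x + y"] in linarith)
qed

lemma monad_zero_scaleR: "x \<in> monad_zero \<Longrightarrow> c *\<^sub>R x \<in> monad_zero"
  by (auto simp: monad_zero_def star_seminorm_scaleR infinitesimal_scale)

lemma monad_zero_zero [simp]: "0 \<in> monad_zero"
  by (auto simp: monad_zero_def star_seminorm_zero)

lemma monad_zero_minus: "x \<in> monad_zero \<Longrightarrow> - x \<in> monad_zero"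
  using monad_zero_scaleR [of x "- 1"] by simp

lemma inf_close_refl [simp]: "x \<sim>\<^sub>* x"
  by (simp add: inf_close_def)

lemma inf_close_sym: "x \<sim>\<^sub>* y \<Longrightarrow> y \<sim>\<^sub>* x"
  using monad_zero_minus by (fastforce simp: inf_close_def)

lemma inf_close_trans: "x \<sim>\<^sub>* y \<Longrightarrow> y \<sim>\<^sub>* z \<Longrightarrow> x \<sim>\<^sub>* z"
  using monad_zero_add by (fastforce simp: inf_close_def)

lemma inf_close_add: "x \<sim>\<^sub>* y \<Longrightarrow> x' \<sim>\<^sub>* y' \<Longrightarrow> x + x' \<sim>\<^sub>* y + y'"
  by (simp add: inf_close_def add_diff_add monad_zero_add)

lemma inf_close_minus: "x \<sim>\<^sub>* y \<Longrightarrow> - x \<sim>\<^sub>* - y"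
  using monad_zero_minus by (fastforce simp: inf_close_def)

lemma inf_close_diff: "x \<sim>\<^sub>* y \<Longrightarrow> x' \<sim>\<^sub>* y' \<Longrightarrow> x - x' \<sim>\<^sub>* y - y'"
  using inf_close_add [OF _ inf_close_minus, of x y x' y'] by simp

lemma inf_close_scaleR: "x \<sim>\<^sub>* y \<Longrightarrow> c *\<^sub>R x \<sim>\<^sub>* c *\<^sub>R y"
  by (simp add: inf_close_def monad_zero_scaleR flip: scaleR_diff_right)

lemma inf_close_st_eq:
  assumes p: "continuous_seminorm p" and x: "x \<in> finite_points" and c: "x \<sim>\<^sub>* y"
  shows "st (star_map p x) = st (star_map p y)"
proof (rule st_eq)
  show "hfinite (star_map p x)" using p x by (simp add: finite_points_def)
  show "infinitesimal (star_map p x - star_map p y)"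
  proof (rule infinitesimal_mono)
    show "infinitesimal (star_map p (x - y))"
      using p c by (simp add: inf_close_def monad_zero_def)
    show "\<bar>star_map p x - star_map p y\<bar> \<le> \<bar>star_map p (x - y)\<bar>"
      using star_seminorm_add [OF p, of "x - y" y] star_seminorm_add [OF p, of "y - x" x]
        star_seminorm_minus [OF p, of "x - y"] star_seminorm_nonneg [OF p, of "x - y"]
      by simp
  qed
qed


section \<open>Nonstandard hulls\<close>

quotient_type (overloaded) ('i, 'e) ns_hull =
  "('i::nonstandard_index, 'e::locally_convex_space) star" /
  partial: "\<lambda>x y. x \<in> finite_points \<and> y \<in> finite_points \<and> x \<sim>\<^sub>* y"
  morphisms rep_hull hull_class
proof (rule part_equivpI)
  show "\<exists>x :: ('i, 'e) star. x \<in> finite_points \<and> x \<in> finite_points \<and> x \<sim>\<^sub>* x"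
    by (rule exI [of _ 0]) simp
  show "symp (\<lambda>x y :: ('i, 'e) star. x \<in> finite_points \<and> y \<in> finite_points \<and> x \<sim>\<^sub>* y)"
    by (auto simp: symp_def intro: inf_close_sym)
  show "transp (\<lambda>x y :: ('i, 'e) star. x \<in> finite_points \<and> y \<in> finite_points \<and> x \<sim>\<^sub>* y)"
    by (auto simp: transp_def intro: inf_close_trans)
qed

text \<open>\<open>rep_hull\<close> picks some representative; \<open>hull_class x\<close> is meaningful for finite \<open>x\<close> only.\<close>

lemma hull_cases [case_names hull_class, cases type: ns_hull]:
  obtains x where "x \<in> finite_points" "X = hull_class x"
proof
  show "rep_hull X \<in> finite_points"
    using Quotient_rep_reflp [OF Quotient_ns_hull, of X] by simp
  show "X = hull_class (rep_hull X)"
    using Quotient_abs_rep [OF Quotient_ns_hull, of X] by simp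
qed

lemma rep_hull_class:
  "x \<in> finite_points \<Longrightarrow> rep_hull (hull_class x) \<in> finite_points \<and> x \<sim>\<^sub>* rep_hull (hull_class x)"
  using Quotient_rep_abs [OF Quotient_ns_hull, of x] inf_close_sym by auto

lemma hull_class_eq_iff:
  "x \<in> finite_points \<Longrightarrow> y \<in> finite_points \<Longrightarrow> hull_class x = hull_class y \<longleftrightarrow> x \<sim>\<^sub>* y"
  using Quotient_rel [OF Quotient_ns_hull, of x y] by auto

definition hull_seminorm ::
  "('e::locally_convex_space \<Rightarrow> real) \<Rightarrow> ('i::nonstandard_index, 'e) ns_hull \<Rightarrow> real" where
  "hull_seminorm p X = st (star_map p (rep_hull X))"

lemma hull_seminorm_class:
  "continuous_seminorm p \<Longrightarrow> x \<in> finite_points \<Longrightarrow>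
    hull_seminorm p (hull_class x) = st (star_map p x)"
  unfolding hull_seminorm_def
  by (rule inf_close_st_eq [symmetric]) (simp_all add: rep_hull_class)

instantiation ns_hull :: (nonstandard_index, locally_convex_space) real_vector
begin

lift_definition zero_ns_hull :: "('a, 'b) ns_hull" is 0
  by simp

lift_definition plus_ns_hull :: "('a, 'b) ns_hull \<Rightarrow> ('a, 'b) ns_hull \<Rightarrow> ('a, 'b) ns_hull" is "(+)"
  by (simp add: finite_points_add inf_close_add)

lift_definition minus_ns_hull :: "('a, 'b) ns_hull \<Rightarrow> ('a, 'b) ns_hull \<Rightarrow> ('a, 'b) ns_hull" is "(-)"
  by (simp add: finite_points_diff inf_close_diff)

lift_definition uminus_ns_hull :: "('a, 'b) ns_hull \<Rightarrow> ('a, 'b) ns_hull" is uminus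
  by (simp add: finite_points_minus inf_close_minus)

lift_definition scaleR_ns_hull :: "real \<Rightarrow> ('a, 'b) ns_hull \<Rightarrow> ('a, 'b) ns_hull" is scaleR
  by (simp add: finite_points_scaleR inf_close_scaleR)

lemma hull_ops:
  "0 = hull_class 0"
  "x \<in> finite_points \<Longrightarrow> y \<in> finite_points \<Longrightarrow> hull_class x + hull_class y = hull_class (x + y)"
  "x \<in> finite_points \<Longrightarrow> y \<in> finite_points \<Longrightarrow> hull_class x - hull_class y = hull_class (x - y)"
  "x \<in> finite_points \<Longrightarrow> - hull_class x = hull_class (- x)"
  "x \<in> finite_points \<Longrightarrow> c *\<^sub>R hull_class x = hull_class (c *\<^sub>R x)"
  by (simp_all add: zero_ns_hull.abs_eq plus_ns_hull.abs_eq minus_ns_hull.abs_eq uminus_ns_hull.abs_eq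
      scaleR_ns_hull.abs_eq)

lemmas finite_points_closed =
  finite_points_add finite_points_diff finite_points_minus finite_points_scaleR

instance
proof
  fix a b c :: "('a, 'b) ns_hull" and r s :: real
  show "a + b + c = a + (b + c)"
    by (cases a; cases b; cases c) (simp add: hull_ops finite_points_closed add.assoc)
  show "a + b = b + a"
    by (cases a; cases b) (simp add: hull_ops add.commute)
  show "0 + a = a"
    by (cases a) (simp add: hull_ops)
  show "- a + a = 0"
    by (cases a) (simp add: hull_ops finite_points_closed)
  show "a - b = a + - b"
    by (cases a; cases b) (simp add: hull_ops finite_points_closed)
  show "r *\<^sub>R (a + b) = r *\<^sub>R a + r *\<^sub>R b"
    by (cases a; cases b) (simp add: hull_ops finite_points_closed scaleR_add_right)
  show "(r + s) *\<^sub>R a = r *\<^sub>R a + s *\<^sub>R a"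
    by (cases a) (simp add: hull_ops finite_points_closed scaleR_add_left)
  show "r *\<^sub>R s *\<^sub>R a = (r * s) *\<^sub>R a"
    by (cases a) (simp add: hull_ops finite_points_closed)
  show "1 *\<^sub>R a = a"
    by (cases a) (simp add: hull_ops)
qed

end

context
  fixes p :: "'e::locally_convex_space \<Rightarrow> real"
  assumes p: "continuous_seminorm p"
begin

lemma hfinite_star_seminorm: "x \<in> finite_points \<Longrightarrow> hfinite (star_map p x)"
  using p by (simp add: finite_points_def)

lemma hull_seminorm_triangle: "hull_seminorm p (X + Y) \<le> hull_seminorm p X + hull_seminorm p Y"
proof (cases X; cases Y)
  fix x y assume "x \<in> finite_points" "X = hull_class x" "y \<in> finite_points" "Y = hull_class y"
  then show ?thesis
    by (simp add: hull_ops hull_seminorm_class p finite_points_closed hfinite_star_seminorm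
        hfinite_add star_seminorm_add st_mono flip: st_add)
qed

lemma hull_seminorm_scaleR: "hull_seminorm p (c *\<^sub>R X) = \<bar>c\<bar> * hull_seminorm p X"
  by (cases X) (simp add: hull_ops hull_seminorm_class p finite_points_closed
      hfinite_star_seminorm star_seminorm_scaleR st_scale)

lemma hull_seminorm_0 [simp]: "hull_seminorm p 0 = 0"
  using hull_seminorm_scaleR [of 0 0] by simp

lemma hull_seminorm_minus [simp]: "hull_seminorm p (- X) = hull_seminorm p X"
  using hull_seminorm_scaleR [of "- 1" X] by simp

lemma hull_seminorm_nonneg [simp]: "0 \<le> hull_seminorm p X"
  using hull_seminorm_triangle [of X "- X"] by simp

lemma hull_seminorm_diff_le:
  "hull_seminorm p (X - Z) \<le> hull_seminorm p (X - Y) + hull_seminorm p (Y - Z)"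
  using hull_seminorm_triangle [of "X - Y" "Y - Z"] by simp

lemma hull_seminorm_commute: "hull_seminorm p (X - Y) = hull_seminorm p (Y - X)"
  using hull_seminorm_minus [of "X - Y"] by simp

end

lemma hull_seminorm_add:
  assumes p: "continuous_seminorm p" and q: "continuous_seminorm q"
  shows "hull_seminorm (\<lambda>x. p x + q x) X = hull_seminorm p X + hull_seminorm q X"
proof (cases X)
  case (hull_class x)
  have "star_map (\<lambda>x. p x + q x) x = star_map p x + star_map q x"
    by (cases x) (simp add: star_map_mk plus_mk admissible_map [of _ p] admissible_map [of _ q])
  with hull_class show ?thesis
    by (simp add: hull_seminorm_class p q continuous_seminorm_add hfinite_star_seminorm st_add)
qed

lemma hull_separated:
  assumes "\<And>p. continuous_seminorm p \<Longrightarrow> hull_seminorm p X = 0"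
  shows "X = 0"
proof (cases X)
  case (hull_class x)
  have "infinitesimal (star_map p x)" if "continuous_seminorm p" for p
    using assms [OF that] that hull_class
    by (simp add: hull_seminorm_class st_eq_0_iff hfinite_star_seminorm)
  then have "x \<sim>\<^sub>* 0" by (simp add: inf_close_def monad_zero_def)
  with hull_class show ?thesis by (simp add: hull_ops hull_class_eq_iff)
qed

instantiation ns_hull :: (nonstandard_index, locally_convex_space) topological_space
begin

definition open_ns_hull :: "('a, 'b) ns_hull set \<Rightarrow> bool" where
  "open_ns_hull = generate_topology
    {{Y. hull_seminorm p (Y - X) < e} | p X e. continuous_seminorm p \<and> 0 < e}"

instance
  using topological_space_generate_topology
  by intro_classes (auto simp: open_ns_hull_def class.topological_space_def)

end

lemma open_hull_ball:
  fixes X :: "('i::nonstandard_index, 'e::locally_convex_space) ns_hull"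
  assumes "continuous_seminorm p"
  shows "open {Y. hull_seminorm p (Y - X) < e}"
proof (cases "e > 0")
  case True
  with assms show ?thesis unfolding open_ns_hull_def by (auto intro: generate_topology.Basis)
next
  case False
  then have "\<not> hull_seminorm p (Y - X) < e" for Y
    using hull_seminorm_nonneg [OF assms, of "Y - X"] by linarith
  then show ?thesis by simp
qed

lemma open_hull_contains_ball:
  fixes X :: "('i::nonstandard_index, 'e::locally_convex_space) ns_hull"
  assumes "open S" "X \<in> S"
  shows "\<exists>p e. continuous_seminorm p \<and> e > 0 \<and> {Y. hull_seminorm p (Y - X) < e} \<subseteq> S"
  using assms unfolding open_ns_hull_def
proof (induction S rule: generate_topology.induct)
  case UNIV
  then show ?case using continuous_seminorm_0 zero_less_one by blast
next
  case (Int A B)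
  from Int.IH(1) Int.prems obtain p d where pd: "continuous_seminorm p" "d > 0"
    "{Y. hull_seminorm p (Y - X) < d} \<subseteq> A" by blast
  from Int.IH(2) Int.prems obtain q e where qe: "continuous_seminorm q" "e > 0"
    "{Y. hull_seminorm q (Y - X) < e} \<subseteq> B" by blast
  note pq = pd(1) qe(1) pd(2) qe(2) and sub = pd(3) qe(3)
  have "{Y. hull_seminorm (\<lambda>x. p x + q x) (Y - X) < min d e} \<subseteq> A \<inter> B"
  proof
    fix Y assume "Y \<in> {Y. hull_seminorm (\<lambda>x. p x + q x) (Y - X) < min d e}"
    then have "hull_seminorm p (Y - X) + hull_seminorm q (Y - X) < min d e"
      by (simp add: hull_seminorm_add pq)
    then have "hull_seminorm p (Y - X) < d" "hull_seminorm q (Y - X) < e"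
      using hull_seminorm_nonneg [OF pq(1), of "Y - X"] hull_seminorm_nonneg [OF pq(2), of "Y - X"]
      by linarith+
    with sub show "Y \<in> A \<inter> B" by blast
  qed
  with pq show ?case
    by (intro exI [of _ "\<lambda>x. p x + q x"] exI [of _ "min d e"]) (simp add: continuous_seminorm_add)
next
  case (UN K)
  then obtain k where "k \<in> K" "X \<in> k" by blast
  with UN.IH [of k] show ?case by blast
next
  case (Basis s)
  then obtain p Z e where s: "s = {Y. hull_seminorm p (Y - Z) < e}" "continuous_seminorm p"
    by blast
  with Basis have "hull_seminorm p (X - Z) < e" by blast
  moreover have "{Y. hull_seminorm p (Y - X) < e - hull_seminorm p (X - Z)} \<subseteq> s"
  proof
    fix Y assume "Y \<in> {Y. hull_seminorm p (Y - X) < e - hull_seminorm p (X - Z)}"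
    with hull_seminorm_diff_le [OF s(2), of Y Z X] show "Y \<in> s"
      unfolding s(1) by simp
  qed
  ultimately show ?case using s(2)
    by (intro exI [of _ p] exI [of _ "e - hull_seminorm p (X - Z)"]) simp
qed

lemma tendsto_hull_iff:
  fixes L :: "('i::nonstandard_index, 'e::locally_convex_space) ns_hull"
  shows "(g \<longlongrightarrow> L) F \<longleftrightarrow>
    (\<forall>p. continuous_seminorm p \<longrightarrow> ((\<lambda>x. hull_seminorm p (g x - L)) \<longlongrightarrow> 0) F)"
proof (intro iffI allI impI)
  fix p :: "'e \<Rightarrow> real"
  assume g: "(g \<longlongrightarrow> L) F" and p: "continuous_seminorm p"
  show "((\<lambda>x. hull_seminorm p (g x - L)) \<longlongrightarrow> 0) F"
  proof (rule order_tendstoI)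
    fix a :: real assume "a < 0"
    then show "\<forall>\<^sub>F x in F. a < hull_seminorm p (g x - L)"
      by (intro always_eventually allI less_le_trans [OF _ hull_seminorm_nonneg [OF p]])
  next
    fix a :: real assume "0 < a"
    then show "\<forall>\<^sub>F x in F. hull_seminorm p (g x - L) < a"
      using topological_tendstoD [OF g open_hull_ball [OF p, of L a]] p by simp
  qed
next
  assume *: "\<forall>p. continuous_seminorm p \<longrightarrow> ((\<lambda>x. hull_seminorm p (g x - L)) \<longlongrightarrow> 0) F"
  show "(g \<longlongrightarrow> L) F"
  proof (rule topological_tendstoI)
    fix S assume S: "open S" "L \<in> S"
    obtain p e where p: "continuous_seminorm p" "e > 0"
      "{Y. hull_seminorm p (Y - L) < e} \<subseteq> S"
      using open_hull_contains_ball [OF S] by blast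
    then have "\<forall>\<^sub>F x in F. hull_seminorm p (g x - L) < e"
      using * by (intro order_tendstoD(2) [of _ 0]) auto
    then show "\<forall>\<^sub>F x in F. g x \<in> S"
      by eventually_elim (use p(3) in blast)
  qed
qed

instance ns_hull :: (nonstandard_index, locally_convex_space) locally_convex_space
proof
  fix a b :: "('a, 'b) ns_hull"
  have lim: "((\<lambda>x. hull_seminorm p (g x - X)) \<longlongrightarrow> 0) F"
    if "continuous_seminorm p" "filterlim g (nhds X) F"
    for p F X and g :: "'c \<Rightarrow> ('a, 'b) ns_hull"
    using that by (simp add: tendsto_hull_iff)
  show "((\<lambda>x. fst x + snd x) \<longlongrightarrow> a + b) (nhds a \<times>\<^sub>F nhds b)"
    unfolding tendsto_hull_iff
  proof (intro allI impI)
    fix p :: "'b \<Rightarrow> real" assume p: "continuous_seminorm p"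
    show "((\<lambda>x. hull_seminorm p (fst x + snd x - (a + b))) \<longlongrightarrow> 0) (nhds a \<times>\<^sub>F nhds b)"
    proof (rule Lim_null_comparison)
      show "\<forall>\<^sub>F x in nhds a \<times>\<^sub>F nhds b. norm (hull_seminorm p (fst x + snd x - (a + b)))
        \<le> hull_seminorm p (fst x - a) + hull_seminorm p (snd x - b)"
        by (intro always_eventually)
          (simp add: add_diff_add hull_seminorm_triangle [OF p] hull_seminorm_nonneg [OF p])
      show "((\<lambda>x. hull_seminorm p (fst x - a) + hull_seminorm p (snd x - b)) \<longlongrightarrow> 0)
        (nhds a \<times>\<^sub>F nhds b)"
        by (rule tendsto_add_zero; rule lim [OF p])
          (simp_all add: filterlim_fst filterlim_snd)
    qed
  qed
  show "(uminus \<longlongrightarrow> - a) (nhds a)"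
    unfolding tendsto_hull_iff
  proof (intro allI impI)
    fix p :: "'b \<Rightarrow> real" assume p: "continuous_seminorm p"
    have "hull_seminorm p (- x - - a) = hull_seminorm p (x - a)" for x :: "('a, 'b) ns_hull"
      using hull_seminorm_commute [OF p, of x a] by simp
    moreover have "((\<lambda>x. hull_seminorm p (x - a)) \<longlongrightarrow> 0) (nhds a)"
      using tendsto_hull_iff [of "\<lambda>x. x" a "nhds a"] p by (simp add: filterlim_ident)
    ultimately show "((\<lambda>x. hull_seminorm p (- x - - a)) \<longlongrightarrow> 0) (nhds a)" by simp
  qed
  show "\<exists>U V. open U \<and> open V \<and> a \<in> U \<and> b \<in> V \<and> U \<inter> V = {}" if "a \<noteq> b"
  proof -
    from that hull_separated [of "a - b"] obtain p :: "'b \<Rightarrow> real"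
      where p: "continuous_seminorm p" "hull_seminorm p (a - b) \<noteq> 0" by auto
    define e where "e = hull_seminorm p (a - b)"
    have e: "e > 0" using p hull_seminorm_nonneg [OF p(1), of "a - b"] unfolding e_def by linarith
    have "{Y. hull_seminorm p (Y - a) < e / 2} \<inter> {Y. hull_seminorm p (Y - b) < e / 2} = {}"
    proof (intro equals0I)
      fix Y assume "Y \<in> {Y. hull_seminorm p (Y - a) < e / 2} \<inter> {Y. hull_seminorm p (Y - b) < e / 2}"
      then have "hull_seminorm p (a - Y) + hull_seminorm p (Y - b) < e"
        using hull_seminorm_commute [OF p(1), of a Y] by simp
      with hull_seminorm_diff_le [OF p(1), of a b Y] show False by (simp add: e_def)
    qed
    moreover have "a \<in> {Y. hull_seminorm p (Y - a) < e / 2}" "b \<in> {Y. hull_seminorm p (Y - b) < e / 2}"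
      using e p by simp_all
    ultimately show ?thesis
      using open_hull_ball [OF p(1), of a "e / 2"] open_hull_ball [OF p(1), of b "e / 2"] by blast
  qed
  show "filterlim (\<lambda>(r, x). r *\<^sub>R x) (nhds (c *\<^sub>R a)) (nhds c \<times>\<^sub>F nhds a)" for c :: real
    unfolding tendsto_hull_iff
  proof (intro allI impI)
    fix p :: "'b \<Rightarrow> real" assume p: "continuous_seminorm p"
    have fst: "(fst \<longlongrightarrow> c) (nhds c \<times>\<^sub>F nhds a)" by (rule filterlim_fst)
    show "((\<lambda>x. hull_seminorm p ((case x of (r, x) \<Rightarrow> r *\<^sub>R x) - c *\<^sub>R a)) \<longlongrightarrow> 0) (nhds c \<times>\<^sub>F nhds a)"
    proof (rule Lim_null_comparison)
      have "hull_seminorm p (r *\<^sub>R x - c *\<^sub>R a)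
          \<le> \<bar>r\<bar> * hull_seminorm p (x - a) + \<bar>r - c\<bar> * hull_seminorm p a" for r x
      proof -
        have "r *\<^sub>R x - c *\<^sub>R a = r *\<^sub>R (x - a) + (r - c) *\<^sub>R a"
          by (simp add: algebra_simps)
        then show ?thesis
          using hull_seminorm_triangle [OF p, of "r *\<^sub>R (x - a)" "(r - c) *\<^sub>R a"]
          by (simp add: hull_seminorm_scaleR [OF p])
      qed
      then show "\<forall>\<^sub>F x in nhds c \<times>\<^sub>F nhds a.
          norm (hull_seminorm p ((case x of (r, x) \<Rightarrow> r *\<^sub>R x) - c *\<^sub>R a))
            \<le> \<bar>fst x\<bar> * hull_seminorm p (snd x - a) + \<bar>fst x - c\<bar> * hull_seminorm p a"
        by (intro always_eventually) (simp add: case_prod_unfold hull_seminorm_nonneg [OF p])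
      have "((\<lambda>x. \<bar>fst x\<bar> * hull_seminorm p (snd x - a) + \<bar>fst x - c\<bar> * hull_seminorm p a)
          \<longlongrightarrow> \<bar>c\<bar> * 0 + \<bar>c - c\<bar> * hull_seminorm p a) (nhds c \<times>\<^sub>F nhds a)"
        by (intro tendsto_intros fst lim [OF p] filterlim_snd)
      then show "((\<lambda>x. \<bar>fst x\<bar> * hull_seminorm p (snd x - a) + \<bar>fst x - c\<bar> * hull_seminorm p a)
          \<longlongrightarrow> 0) (nhds c \<times>\<^sub>F nhds a)"
        by simp
    qed
  qed
  show "\<exists>V W. (\<forall>x\<in>V. \<forall>y\<in>V. \<forall>u\<ge>0. \<forall>v\<ge>0. u + v = (1::real) \<longrightarrow> u *\<^sub>R x + v *\<^sub>R y \<in> V) \<and>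
      open W \<and> 0 \<in> W \<and> W \<subseteq> V \<and> V \<subseteq> S" if S: "open S" "0 \<in> S" for S :: "('a, 'b) ns_hull set"
  proof -
    from open_hull_contains_ball [OF S] obtain p e where p: "continuous_seminorm p" "e > 0"
      "{Y. hull_seminorm p (Y - 0) < e} \<subseteq> S" by auto
    let ?V = "{Y :: ('a, 'b) ns_hull. hull_seminorm p (Y - 0) < e}"
    have "convex ?V"
    proof (rule convexI)
      fix x y :: "('a, 'b) ns_hull" and u v :: real
      assume xy: "x \<in> ?V" "y \<in> ?V" and uv: "u \<ge> 0" "v \<ge> 0" "u + v = 1"
      have "hull_seminorm p (u *\<^sub>R x + v *\<^sub>R y) \<le> u * hull_seminorm p x + v * hull_seminorm p y"
        using hull_seminorm_triangle [OF p(1), of "u *\<^sub>R x" "v *\<^sub>R y"] uv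
        by (simp add: hull_seminorm_scaleR [OF p(1)])
      also have "\<dots> < e"
        using xy uv by (intro convex_bound_lt) auto
      finally show "u *\<^sub>R x + v *\<^sub>R y \<in> ?V" by simp
    qed
    moreover have "open ?V" "0 \<in> ?V"
      using open_hull_ball [OF p(1), of 0 e] p by simp_all
    ultimately show ?thesis using p(3) unfolding convex_def starlike_def by blast
  qed
qed

section \<open>Differentiability\<close>

definition hyper_scaleR ::
  "('i::nonstandard_index, real) star \<Rightarrow> ('i, 'e::real_vector) star \<Rightarrow> ('i, 'e) star"
  (infixr \<open>*\<^sub>H\<close> 75) where
  "c *\<^sub>H x = star_map2 scaleR c x"

definition FLin ::
  "('i::nonstandard_index, 'e::locally_convex_space \<Rightarrow> 'f::locally_convex_space) star set" where
  "FLin = {T \<in> star_set {L. linear L}. \<forall>x\<in>finite_points. T $* x \<in> finite_points}"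

text \<open>\<open>df\<close> is a map from \<open>U\<close> to linear maps; its extension at \<open>a\<close> is the internal function
  \<open>star_map df a\<close>. The values of \<open>f\<close> and \<open>df\<close> off \<open>U\<close> are irrelevant: for \<open>a\<close> in the interior,
  finite \<open>h\<close> and infinitesimal \<open>\<delta>\<close>, the point \<open>a + \<delta> h\<close> lies in \<open>star_set U\<close>.\<close>

definition uniformly_differentiable_at_finite_points ::
  "'i::nonstandard_index itself \<Rightarrow> 'e::locally_convex_space set \<Rightarrow>
    ('e \<Rightarrow> 'f::locally_convex_space) \<Rightarrow> bool" where
  "uniformly_differentiable_at_finite_points _ U f \<longleftrightarrow>
    (\<exists>df :: 'e \<Rightarrow> 'e \<Rightarrow> 'f. (\<forall>x\<in>U. linear (df x)) \<and>
      (\<forall>a :: ('i, 'e) star. a \<in> star_interior U \<inter> finite_points \<longrightarrow>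
        star_map df a \<in> FLin \<and>
        (\<forall>h\<in>finite_points. \<forall>\<delta>. 0 < \<delta> \<and> infinitesimal \<delta> \<longrightarrow>
          (1 / \<delta>) *\<^sub>H (star_map f (a + \<delta> *\<^sub>H h) - star_map f a) \<sim>\<^sub>* star_map df a $* h)))"

definition C1_on ::
  "'e::locally_convex_space set \<Rightarrow> ('e \<Rightarrow> 'f::locally_convex_space) \<Rightarrow> bool" where
  "C1_on S g \<longleftrightarrow> open S \<and>
    (\<exists>dg. (\<forall>a\<in>S. \<forall>h. ((\<lambda>t::real. (1 / t) *\<^sub>R (g (a + t *\<^sub>R h) - g a)) \<longlongrightarrow> dg a h) (at 0)) \<and>
      continuous_on (S \<times> UNIV) (\<lambda>(a, h). dg a h))"


section \<open>The induced map on nonstandard hulls\<close>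

definition seminorm_representation ::
  "'k set \<Rightarrow> ('k \<Rightarrow> nat) \<Rightarrow> ('k \<Rightarrow> nat \<Rightarrow> 'e::locally_convex_space \<Rightarrow> real) \<Rightarrow>
    ('k \<Rightarrow> nat \<Rightarrow> 'e) \<Rightarrow> ('k \<Rightarrow> nat \<Rightarrow> real) \<Rightarrow> 'e set \<Rightarrow> bool" where
  "seminorm_representation I n p c \<epsilon> U \<longleftrightarrow>
    (\<forall>i\<in>I. \<forall>j\<in>{1..n i}. continuous_seminorm (p i j) \<and> 0 < \<epsilon> i j) \<and>
    U = (\<Union>i\<in>I. \<Inter>j\<in>{1..n i}. {x. p i j (x - c i j) < \<epsilon> i j})"

definition hull_set ::
  "'k set \<Rightarrow> ('k \<Rightarrow> nat) \<Rightarrow> ('k \<Rightarrow> nat \<Rightarrow> 'e::locally_convex_space \<Rightarrow> real) \<Rightarrow>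
    ('k \<Rightarrow> nat \<Rightarrow> 'e) \<Rightarrow> ('k \<Rightarrow> nat \<Rightarrow> real) \<Rightarrow> ('i::nonstandard_index, 'e) ns_hull set" where
  "hull_set I n p c \<epsilon> =
    (\<Union>i\<in>I. \<Inter>j\<in>{1..n i}. {X. hull_seminorm (p i j) (X - hull_class (star_of (c i j))) < \<epsilon> i j})"

text \<open>Saturation for families of at most \<open>|'e + 'f \<Rightarrow> real|\<close> internal sets (in particular for families
  indexed by continuous seminorms on the two spaces). Lists over the sum type encode tuples of
  points of the two spaces and of real numbers, so that internal subsets of all finite products of
  the three are covered.\<close>

definition sufficiently_saturated ::
  "'i::nonstandard_index itself \<Rightarrow> 'e itself \<Rightarrow> 'f itself \<Rightarrow> bool" where
  "sufficiently_saturated _ _ _ \<longleftrightarrow>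
    saturated TYPE('e + 'f \<Rightarrow> real) TYPE(('i, ('e + 'f + real) list) star)"

text \<open>\<open>hull_map\<close> takes an arbitrary representative. For \<open>f\<close> mapping finite points of \<open>star_set U\<close> to
  finite points and uniformly differentiable at finite points the choice is immaterial on
  \<open>hull_set\<close>.\<close>

definition hull_map ::
  "('e::locally_convex_space \<Rightarrow> 'f::locally_convex_space) \<Rightarrow>
    ('i::nonstandard_index, 'e) ns_hull \<Rightarrow> ('i, 'f) ns_hull" where
  "hull_map f X = hull_class (star_map f (rep_hull X))"

end

theory Submission
  imports Defs
begin

text \<open>
  The derivative of the induced map is induced by \<open>df\<close>: it sends the classes of \<open>a\<close> and \<open>h\<close> to the
  class of \<open>df(a)(h)\<close>. Everything rests on one form of saturation, \<open>seminorm_saturation\<close>: internal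
  conditions that shrink as a continuous seminorm grows and a positive real decreases, and that are
  satisfiable one at a time, are satisfiable all at once. Three instances are used.

  First (\<open>monad_zero_rescale\<close>), every \<open>z\<close> in the monad of \<open>0\<close> equals \<open>\<delta> k\<close> with \<open>\<delta>\<close> a positive
  infinitesimal and \<open>k\<close> still in the monad of \<open>0\<close>. Hence moving \<open>a\<close> to a nearby point \<open>b = a + \<delta> k\<close>
  is a step to which differentiability at \<open>a\<close> applies. It shows that \<open>f(b)\<close> is close to \<open>f(a)\<close>, and,
  after writing the increment of \<open>f\<close> from \<open>b\<close> to \<open>b + \<delta> h\<close> as the difference of the increments from
  \<open>a\<close> to \<open>a + \<delta> (k + h)\<close> and from \<open>a\<close> to \<open>a + \<delta> k\<close>, that \<open>df(b)(h)\<close> is close to \<open>df(a)(h)\<close>. The same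
  rescaling applied to \<open>h\<close>, together with linearity and preservation of finite points, shows that
  \<open>df(a)\<close> maps the monad of \<open>0\<close> into the monad of \<open>0\<close>. So \<open>df(a)(h)\<close> depends on the classes of \<open>a\<close>
  and \<open>h\<close> only.

  The other two instances turn these infinitesimal statements into limits on the hull. If the
  difference quotients along real \<open>t > 0\<close> stayed away from \<open>df(a)(h)\<close> for arbitrarily small \<open>t\<close>,
  saturation would produce an infinitesimal \<open>t\<close> with that property; if \<open>df(b)(k)\<close> stayed away from
  \<open>df(a)(h)\<close> for points arbitrarily close to \<open>(a, h)\<close>, it would produce such a pair \<open>(b, k)\<close>
  infinitely close to \<open>(a, h)\<close>.
\<close>

section \<open>Saturation along continuous seminorms\<close>

lemma saturatedD:
  fixes A :: "'k \<Rightarrow> ('i::nonstandard_index, 'a set) star"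
  assumes "saturated TYPE('k) TYPE(('i, 'a) star)"
    and "\<And>K. finite K \<Longrightarrow> \<exists>x. \<forall>k\<in>K. star_mem x (A k)"
  obtains x where "\<forall>k. star_mem x (A k)"
proof -
  have "\<exists>x. \<forall>k. star_mem x (A k)"
    using assms unfolding saturated_def by simp
  then show ?thesis using that by blast
qed

text \<open>Saturation passes to index types that are images and to point types that embed, since the
  internal sets can be pulled back along the former map and pushed forward along the latter.\<close>

lemma saturated_transfer:
  fixes g :: "'k \<Rightarrow> 'l" and enc :: "'a \<Rightarrow> 'b"
  assumes sat: "saturated TYPE('k) TYPE(('i::nonstandard_index, 'b) star)"
    and g: "surj g" and enc: "inj enc"
  shows "saturated TYPE('l) TYPE(('i, 'a) star)"
  unfolding saturated_def
proof (intro allI impI)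
  fix A :: "'l \<Rightarrow> ('i, 'a set) star"
  assume fip: "\<forall>K. finite K \<longrightarrow> (\<exists>x. \<forall>k\<in>K. star_mem x (A k))"
  have push: "star_mem (star_map enc x) (star_map (image enc) B)"
    if "star_mem x B" for x :: "('i, 'a) star" and B
    using that
    by (cases x; cases B) (simp add: star_map_mk star_mem_mk admissible_map, erule eventually_mono, simp)
  have pull: "star_mem (star_map (inv enc) y) B"
    if "star_mem y (star_map (image enc) B)" for y :: "('i, 'b) star" and B
    using that enc
    by (cases y; cases B) (simp add: star_map_mk star_mem_mk admissible_map, erule eventually_mono, auto)
  have "\<exists>y. \<forall>k\<in>K. star_mem y (star_map (image enc) (A (g k)))" if "finite K" for K
  proof -
    obtain x where "\<forall>l\<in>g ` K. star_mem x (A l)" using fip \<open>finite K\<close> by blast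
    then show ?thesis by (intro exI [of _ "star_map enc x"]) (simp add: push)
  qed
  then obtain y where "\<forall>k. star_mem y (star_map (image enc) (A (g k)))"
    by (rule saturatedD [OF sat])
  then have "star_mem (star_map (inv enc) y) (A (g k))" for k
    by (intro pull) simp
  then show "\<exists>x. \<forall>l. star_mem x (A l)"
    using g by (metis surj_def)
qed

text \<open>The index type of \<^const>\<open>sufficiently_saturated\<close> is large enough for pairs of a real function on the
  first type and a real bound: restrict the index to the first summand, and evaluate it at a point
  of the second.\<close>

lemma sufficiently_saturated_transfer:
  fixes enc :: "'a \<Rightarrow> ('e + 'f + real) list"
  assumes "sufficiently_saturated TYPE('i::nonstandard_index) TYPE('e) TYPE('f)" and "inj enc"
  shows "saturated TYPE(('e \<Rightarrow> real) \<times> real) TYPE(('i, 'a) star)"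
proof (rule saturated_transfer)
  let ?g = "\<lambda>k :: 'e + 'f \<Rightarrow> real. (\<lambda>x. k (Inl x), k (Inr undefined))"
  show "saturated TYPE('e + 'f \<Rightarrow> real) TYPE(('i, ('e + 'f + real) list) star)"
    using assms(1) by (simp add: sufficiently_saturated_def)
  show "surj ?g"
  proof (rule surjI)
    show "?g (case_sum (fst pr) (\<lambda>_. snd pr)) = pr" for pr by simp
  qed
qed fact

lemma saturated_real:
  assumes "sufficiently_saturated TYPE('i::nonstandard_index) TYPE('e) TYPE('f)"
  shows "saturated TYPE(('e \<Rightarrow> real) \<times> real) TYPE(('i, real) star)"
  by (rule sufficiently_saturated_transfer [OF assms, where enc = "\<lambda>r. [Inr (Inr r)]"])
    (simp add: inj_def)

lemma saturated_pair:
  assumes "sufficiently_saturated TYPE('i::nonstandard_index) TYPE('e) TYPE('f)"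
  shows "saturated TYPE(('e \<Rightarrow> real) \<times> real) TYPE(('i, 'e \<times> 'e) star)"
  by (rule sufficiently_saturated_transfer [OF assms, where enc = "\<lambda>(b, k). [Inl b, Inl k]"])
    (auto simp: inj_def)

lemma continuous_seminorms_directed:
  fixes K :: "(('e::locally_convex_space \<Rightarrow> real) \<times> real) set"
  assumes "finite K" and "\<And>p r. (p, r) \<in> K \<Longrightarrow> continuous_seminorm p \<and> 0 < r"
  shows "\<exists>q s. continuous_seminorm q \<and> 0 < s \<and> (\<forall>(p, r)\<in>K. (\<forall>x. p x \<le> q x) \<and> s \<le> r)"
  using assms
proof (induction K)
  case empty
  show ?case
    by (rule exI [of _ "\<lambda>x. 0"], rule exI [of _ 1]) (simp add: continuous_seminorm_0)
next
  case (insert pr K)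
  obtain q s where q: "continuous_seminorm q" "0 < s"
    "\<forall>(p, r)\<in>K. (\<forall>x. p x \<le> q x) \<and> s \<le> r"
    using insert by blast
  obtain p r where pr: "pr = (p, r)" "continuous_seminorm p" "0 < r"
    using insert.prems by (cases pr) auto
  have *: "p x \<le> p x + q x" "q x \<le> p x + q x" for x
    using continuous_seminormD(6) pr(2) q(1) by auto
  have "\<forall>(p', r')\<in>insert pr K. (\<forall>x. p' x \<le> p x + q x) \<and> min r s \<le> r'"
  proof (clarify, intro conjI allI)
    fix p' r' x assume mem: "(p', r') \<in> insert pr K"
    then have "(p' = p \<and> r' = r) \<or> (p' x \<le> q x \<and> s \<le> r')"
      using bspec [OF q(3), of "(p', r')"] pr(1) by auto
    then show "p' x \<le> p x + q x" "min r s \<le> r'"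
      using * [of x] by auto
  qed
  then show ?case
    using continuous_seminorm_add [OF pr(2) q(1)] pr(3) q(2)
    by (intro exI [of _ "\<lambda>x. p x + q x"] exI [of _ "min r s"]) auto
qed

text \<open>By directedness and monotonicity, finitely many of the conditions follow from a single one, so the
  finite intersection property only asks that each condition be satisfiable.\<close>

lemma seminorm_saturation:
  fixes A :: "('e::locally_convex_space \<Rightarrow> real) \<Rightarrow> real \<Rightarrow> ('i::nonstandard_index, 'a set) star"
  assumes sat: "saturated TYPE(('e \<Rightarrow> real) \<times> real) TYPE(('i, 'a) star)"
    and nonempty: "\<And>p r. continuous_seminorm p \<Longrightarrow> 0 < r \<Longrightarrow> \<exists>x. star_mem x (A p r)"
    and mono: "\<And>p q r s x. (\<And>y. p y \<le> q y) \<Longrightarrow> 0 < s \<Longrightarrow> s \<le> r \<Longrightarrow>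
      star_mem x (A q s) \<Longrightarrow> star_mem x (A p r)"
  shows "\<exists>x. \<forall>p r. continuous_seminorm p \<longrightarrow> 0 < r \<longrightarrow> star_mem x (A p r)"
proof -
  define good where "good = {(p :: 'e \<Rightarrow> real, r :: real). continuous_seminorm p \<and> 0 < r}"
  define B where "B k = (if k \<in> good then A (fst k) (snd k) else star_of UNIV)" for k
  have "\<exists>x. \<forall>k\<in>K. star_mem x (B k)" if "finite K" for K
  proof -
    have fin: "finite (K \<inter> good)" using \<open>finite K\<close> by simp
    have "continuous_seminorm p \<and> 0 < r" if "(p, r) \<in> K \<inter> good" for p r
      using that by (simp add: good_def)
    from continuous_seminorms_directed [OF fin this]
    obtain q s where q: "continuous_seminorm q" "0 < s"
      "\<forall>(p, r)\<in>K \<inter> good. (\<forall>x. p x \<le> q x) \<and> s \<le> r"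
      by blast
    obtain x where x: "star_mem x (A q s)" using nonempty q by blast
    have "star_mem x (B k)" if "k \<in> K" for k
    proof (cases "k \<in> good")
      case True
      with \<open>k \<in> K\<close> q(3) have "\<forall>y. fst k y \<le> q y" "s \<le> snd k"
        by (auto simp: case_prod_beta)
      then have "star_mem x (A (fst k) (snd k))"
        by (intro mono [OF _ q(2) _ x]) auto
      then show ?thesis using True by (simp add: B_def)
    next
      case False
      then show ?thesis by (cases x) (simp add: B_def star_of_mk star_mem_mk)
    qed
    then show ?thesis by blast
  qed
  then obtain x where "\<forall>k. star_mem x (B k)"
    by (rule saturatedD [OF sat])
  then have "star_mem x (A p r)" if "continuous_seminorm p" "0 < r" for p r
    using that spec [OF \<open>\<forall>k. star_mem x (B k)\<close>, of "(p, r)"] by (simp add: B_def good_def)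
  then show ?thesis by blast
qed


section \<open>Hyperreal scalars and infinitesimal scales\<close>

lemma hyper_scaleR_mk:
  "admissible r \<Longrightarrow> admissible x \<Longrightarrow> mk_star r *\<^sub>H mk_star x = mk_star (\<lambda>i. r i *\<^sub>R x i)"
  by (simp add: hyper_scaleR_def star_map2_mk)

lemma hyper_scaleR_star_of: "star_of c *\<^sub>H x = c *\<^sub>R x"
  by (cases x) (simp add: star_of_mk hyper_scaleR_mk scaleR_mk)

lemma hyper_scaleR_diff_right: "c *\<^sub>H (x - y) = c *\<^sub>H x - c *\<^sub>H y"
  by (cases x; cases y; cases c) (simp add: hyper_scaleR_mk minus_mk scaleR_diff_right)

lemma hyper_scaleR_add_right: "c *\<^sub>H (x + y) = c *\<^sub>H x + c *\<^sub>H y"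
  by (cases x; cases y; cases c) (simp add: hyper_scaleR_mk plus_mk scaleR_add_right)

lemma hyper_scaleR_hyper_scaleR: "c *\<^sub>H d *\<^sub>H x = (c * d) *\<^sub>H x"
  by (cases x; cases c; cases d) (simp add: hyper_scaleR_mk times_mk)

lemma hyper_scaleR_one: "1 *\<^sub>H x = x"
  by (cases x) (simp add: hyper_scaleR_mk one_mk)

lemma hyper_scaleR_inverse: "\<delta> \<noteq> 0 \<Longrightarrow> \<delta> *\<^sub>H (1 / \<delta>) *\<^sub>H x = x"
  by (simp add: hyper_scaleR_hyper_scaleR hyper_scaleR_one)

lemma star_seminorm_hyper_scaleR:
  assumes "continuous_seminorm p"
  shows "star_map p (c *\<^sub>H x) = \<bar>c\<bar> * star_map p x"
  by (cases x; cases c)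
    (simp add: hyper_scaleR_mk star_map_mk admissible_map [of _ p] times_mk abs_mk
      continuous_seminormD(2) [OF assms])

lemma monad_zero_finite: "x \<in> monad_zero \<Longrightarrow> x \<in> finite_points"
  by (simp add: monad_zero_def finite_points_def infinitesimal_hfinite)

lemma finite_points_inf_close:
  assumes "a \<in> finite_points" "a \<sim>\<^sub>* b" shows "b \<in> finite_points"
  using finite_points_diff [OF assms(1) monad_zero_finite, of "a - b"] assms(2)
  by (simp add: inf_close_def)

lemma infinitesimal_mult_hfinite:
  assumes "infinitesimal x" "hfinite y" shows "infinitesimal (x * y)"
proof -
  obtain r where r: "\<bar>y\<bar> \<le> star_of r" using assms(2) by (auto simp: hfinite_def)
  show ?thesis
    by (rule infinitesimal_mono [OF infinitesimal_scale [OF assms(1), of r]])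
      (use r in \<open>simp add: abs_mult mult.commute [of "\<bar>x\<bar>"] mult_right_mono\<close>)
qed

lemma infinitesimal_hyper_scaleR:
  fixes x :: "('i::nonstandard_index, 'e::locally_convex_space) star"
  assumes "infinitesimal \<delta>" "x \<in> finite_points"
  shows "\<delta> *\<^sub>H x \<in> monad_zero"
  unfolding monad_zero_def
proof (intro CollectI allI impI)
  fix p :: "'e \<Rightarrow> real" assume p: "continuous_seminorm p"
  have "infinitesimal (\<delta> * star_map p x)"
    using assms by (intro infinitesimal_mult_hfinite hfinite_star_seminorm p)
  then show "infinitesimal (star_map p (\<delta> *\<^sub>H x))"
    by (rule infinitesimal_mono) (simp add: star_seminorm_hyper_scaleR [OF p] abs_mult)
qed

text \<open>There is a positive infinitesimal \<open>\<delta>\<close> that dominates all the infinitesimals \<open>p z\<close>: the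
  conditions \<open>0 < \<delta> < r\<close> and \<open>p z < r \<delta>\<close> are internal, and each is met by the real number
  \<open>r / 2\<close>.\<close>

lemma monad_zero_rescale:
  fixes z :: "('i::nonstandard_index, 'e::locally_convex_space) star"
  assumes sat: "saturated TYPE(('e \<Rightarrow> real) \<times> real) TYPE(('i, real) star)"
    and z: "z \<in> monad_zero"
  obtains \<delta> where "0 < \<delta>" "infinitesimal \<delta>" "(1 / \<delta>) *\<^sub>H z \<in> monad_zero"
proof -
  define A where "A p r = star_map (\<lambda>y. {t. 0 < t \<and> t < r \<and> p y < r * t}) z"
    for p :: "'e \<Rightarrow> real" and r :: real
  have mem: "star_mem \<delta> (A p r) \<longleftrightarrow> 0 < \<delta> \<and> \<delta> < star_of r \<and> star_map p z < star_of r * \<delta>"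
    for p r \<delta>
    by (cases z; cases \<delta>)
      (simp add: A_def star_map_mk star_mem_mk less_mk zero_mk star_of_mk times_mk
        admissible_map [of _ "\<lambda>y. {t. 0 < t \<and> t < r \<and> p y < r * t}"] admissible_map [of _ p]
        eventually_conj_iff)
  have "\<exists>\<delta>. \<forall>p r. continuous_seminorm p \<longrightarrow> 0 < r \<longrightarrow> star_mem \<delta> (A p r)"
  proof (rule seminorm_saturation [OF sat])
    fix p :: "'e \<Rightarrow> real" and r :: real
    assume p: "continuous_seminorm p" and r: "0 < r"
    have "\<bar>star_map p z\<bar> < star_of (r * (r / 2))"
      using z p r unfolding monad_zero_def infinitesimal_def by simp
    then have "star_map p z < star_of r * star_of (r / 2)"
      unfolding star_of_times by linarith
    then have "star_mem (star_of (r / 2)) (A p r)"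
      using r by (simp add: mem)
    then show "\<exists>\<delta>. star_mem \<delta> (A p r)" by blast
  next
    fix p q :: "'e \<Rightarrow> real" and r s :: real and \<delta> :: "('i, real) star"
    assume le: "\<And>y. p y \<le> q y" "0 < s" "s \<le> r" and m: "star_mem \<delta> (A q s)"
    have "star_map p z \<le> star_map q z"
      using le(1) by (cases z) (simp add: star_map_mk le_mk admissible_map)
    moreover have "star_of s * \<delta> \<le> star_of r * \<delta>"
      using m le by (simp add: mem mult_right_mono)
    moreover have "star_of s \<le> (star_of r :: ('i, real) star)" using le by simp
    ultimately show "star_mem \<delta> (A p r)"
      using m unfolding mem by (meson le_less_trans less_le_trans)
  qed
  then obtain \<delta> where \<delta>: "\<And>p r. continuous_seminorm p \<Longrightarrow> 0 < r \<Longrightarrow>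
      0 < \<delta> \<and> \<delta> < star_of r \<and> star_map p z < star_of r * \<delta>"
    unfolding mem by blast
  have pos: "0 < \<delta>" using \<delta> [OF continuous_seminorm_0 zero_less_one] by simp
  show ?thesis
  proof
    show "infinitesimal \<delta>"
      using \<delta> [OF continuous_seminorm_0] pos by (simp add: infinitesimal_def)
    show "(1 / \<delta>) *\<^sub>H z \<in> monad_zero"
      unfolding monad_zero_def infinitesimal_def
    proof (intro CollectI allI impI)
      fix p :: "'e \<Rightarrow> real" and r :: real
      assume p: "continuous_seminorm p" and r: "0 < r"
      show "\<bar>star_map p ((1 / \<delta>) *\<^sub>H z)\<bar> < star_of r"
        using \<delta> [OF p r] pos star_seminorm_nonneg [OF p, of z]
        by (simp add: star_seminorm_hyper_scaleR [OF p] abs_mult pos_divide_less_eq)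
    qed
  qed fact
qed


section \<open>Internal linear maps\<close>

lemma star_linear_diff:
  assumes "T \<in> star_set {L. linear L}"
  shows "T $* (x - y) = T $* x - T $* y"
proof (cases T; cases x; cases y)
  fix L u v assume rep: "admissible L" "T = mk_star L" "admissible u" "x = mk_star u"
    "admissible v" "y = mk_star v"
  have "\<forall>\<^sub>F i in ultra. linear (L i)" using assms rep by (simp add: star_set_mk)
  then have "\<forall>\<^sub>F i in ultra. L i (u i - v i) = L i (u i) - L i (v i)"
    by eventually_elim (rule linear_diff)
  then show ?thesis
    using rep admissible_app [of L u] admissible_app [of L v] admissible_app [of L "\<lambda>i. u i - v i"]
    by (simp add: star_app_mk minus_mk mk_star_eq_iff)
qed

lemma star_linear_hyper_scaleR:
  assumes "T \<in> star_set {L. linear L}"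
  shows "T $* (c *\<^sub>H x) = c *\<^sub>H (T $* x)"
proof (cases T; cases x; cases c)
  fix L u r assume rep: "admissible L" "T = mk_star L" "admissible u" "x = mk_star u"
    "admissible r" "c = mk_star r"
  have "\<forall>\<^sub>F i in ultra. linear (L i)" using assms rep by (simp add: star_set_mk)
  then have "\<forall>\<^sub>F i in ultra. L i (r i *\<^sub>R u i) = r i *\<^sub>R L i (u i)"
    by eventually_elim (rule linear_cmul)
  then show ?thesis
    using rep admissible_app [of L u] admissible_app [of L "\<lambda>i. r i *\<^sub>R u i"]
    by (simp add: star_app_mk hyper_scaleR_mk mk_star_eq_iff)
qed

text \<open>Writing \<open>x = \<delta> k\<close> with \<open>k\<close> finite, the image of \<open>x\<close> is an infinitesimal multiple of the finite
  point \<open>T k\<close>.\<close>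

lemma FLin_monad_zero:
  fixes T :: "('i::nonstandard_index, 'e::locally_convex_space \<Rightarrow> 'f::locally_convex_space) star"
  assumes sat: "saturated TYPE(('e \<Rightarrow> real) \<times> real) TYPE(('i, real) star)"
    and T: "T \<in> FLin" and x: "x \<in> monad_zero"
  shows "T $* x \<in> monad_zero"
proof -
  obtain \<delta> where \<delta>: "0 < \<delta>" "infinitesimal \<delta>" "(1 / \<delta>) *\<^sub>H x \<in> monad_zero"
    by (rule monad_zero_rescale [OF sat x])
  then have "T $* ((1 / \<delta>) *\<^sub>H x) \<in> finite_points"
    using T monad_zero_finite by (auto simp: FLin_def)
  then have "\<delta> *\<^sub>H (T $* ((1 / \<delta>) *\<^sub>H x)) \<in> monad_zero"
    by (rule infinitesimal_hyper_scaleR [OF \<delta>(2)])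
  moreover have "\<delta> *\<^sub>H (T $* ((1 / \<delta>) *\<^sub>H x)) = T $* x"
    using T \<delta>(1) by (simp add: FLin_def flip: star_linear_hyper_scaleR) (simp add: hyper_scaleR_inverse)
  ultimately show ?thesis by simp
qed


section \<open>Infinitesimal behaviour of a differentiable map\<close>

lemma star_interior_inf_close:
  assumes "a \<in> star_interior U" "a \<sim>\<^sub>* b" shows "b \<in> star_interior U"
proof -
  have monad: "x \<in> star_set U" if "a \<sim>\<^sub>* x" for x
  proof -
    have "x - a \<in> monad_zero" using inf_close_sym [OF that] by (simp add: inf_close_def)
    then have "x \<in> monad a" unfolding monad_def by (intro image_eqI [of _ _ "x - a"]) simp_all
    then show ?thesis using assms(1) by (auto simp: star_interior_def)
  qed
  have "monad b \<subseteq> star_set U"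
  proof
    fix x assume "x \<in> monad b"
    then have "x \<sim>\<^sub>* b" by (auto simp: monad_def inf_close_def)
    then show "x \<in> star_set U" using assms(2) monad inf_close_sym inf_close_trans by blast
  qed
  then show ?thesis using monad [OF assms(2)] by (simp add: star_interior_def)
qed

text \<open>\<open>D\<close> stands for the finite points in the interior of the extension of the domain. What matters
  about it is that it is a union of monads of finite points.\<close>

locale finite_point_derivative =
  fixes f :: "'e::locally_convex_space \<Rightarrow> 'f::locally_convex_space"
    and df :: "'e \<Rightarrow> 'e \<Rightarrow> 'f"
    and D :: "('i::nonstandard_index, 'e) star set"
  assumes sat_real: "saturated TYPE(('e \<Rightarrow> real) \<times> real) TYPE(('i, real) star)"
    and sat_pair: "saturated TYPE(('e \<Rightarrow> real) \<times> real) TYPE(('i, 'e \<times> 'e) star)"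
    and D_finite: "a \<in> D \<Longrightarrow> a \<in> finite_points"
    and D_inf_close: "a \<in> D \<Longrightarrow> a \<sim>\<^sub>* b \<Longrightarrow> b \<in> D"
    and f_finite: "a \<in> D \<Longrightarrow> star_map f a \<in> finite_points"
    and df_FLin: "a \<in> D \<Longrightarrow> star_map df a \<in> FLin"
    and derivative: "a \<in> D \<Longrightarrow> h \<in> finite_points \<Longrightarrow> 0 < \<delta> \<Longrightarrow> infinitesimal \<delta> \<Longrightarrow>
      (1 / \<delta>) *\<^sub>H (star_map f (a + \<delta> *\<^sub>H h) - star_map f a) \<sim>\<^sub>* star_map df a $* h"
begin

lemma df_finite: "a \<in> D \<Longrightarrow> h \<in> finite_points \<Longrightarrow> star_map df a $* h \<in> finite_points"
  using df_FLin by (auto simp: FLin_def)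

lemma df_linear: "a \<in> D \<Longrightarrow> star_map df a \<in> star_set {L. linear L}"
  using df_FLin by (auto simp: FLin_def)

text \<open>Dividing \<open>b - a\<close> by a suitable infinitesimal \<open>\<delta>\<close> keeps it finite, so that \<open>f b - f a\<close> is \<open>\<delta>\<close> times
  a point close to a value of \<open>df a\<close>.\<close>

lemma f_inf_close:
  assumes a: "a \<in> D" and ab: "a \<sim>\<^sub>* b"
  shows "star_map f a \<sim>\<^sub>* star_map f b"
proof -
  have "b - a \<in> monad_zero" using inf_close_sym [OF ab] by (simp add: inf_close_def)
  then obtain \<delta> where \<delta>: "0 < \<delta>" "infinitesimal \<delta>" "(1 / \<delta>) *\<^sub>H (b - a) \<in> monad_zero"
    by (rule monad_zero_rescale [OF sat_real])
  define k where "k = (1 / \<delta>) *\<^sub>H (b - a)"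
  have k: "k \<in> finite_points" "a + \<delta> *\<^sub>H k = b"
    using \<delta> by (simp_all add: k_def monad_zero_finite hyper_scaleR_inverse)
  let ?q = "(1 / \<delta>) *\<^sub>H (star_map f b - star_map f a)"
  have "?q \<sim>\<^sub>* star_map df a $* k"
    using derivative [OF a k(1) \<delta>(1,2)] by (simp add: k(2))
  then have "?q \<in> finite_points"
    using finite_points_inf_close inf_close_sym df_finite [OF a k(1)] by blast
  then have "\<delta> *\<^sub>H ?q \<in> monad_zero"
    by (rule infinitesimal_hyper_scaleR [OF \<delta>(2)])
  then have "star_map f b \<sim>\<^sub>* star_map f a"
    using \<delta>(1) by (simp add: hyper_scaleR_inverse inf_close_def)
  then show ?thesis by (rule inf_close_sym)
qed

text \<open>With \<open>b = a + \<delta> k\<close>, the increment of \<open>f\<close> from \<open>b\<close> to \<open>b + \<delta> h\<close> is the increment from \<open>a\<close> to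
  \<open>a + \<delta> (k + h)\<close> minus the one from \<open>a\<close> to \<open>b\<close>; divided by \<open>\<delta>\<close>, these are close to \<open>df a (k + h)\<close>
  and \<open>df a k\<close>.\<close>

lemma df_inf_close_point:
  assumes a: "a \<in> D" and ab: "a \<sim>\<^sub>* b" and h: "h \<in> finite_points"
  shows "star_map df b $* h \<sim>\<^sub>* star_map df a $* h"
proof -
  have b: "b \<in> D" by (rule D_inf_close [OF a ab])
  have "b - a \<in> monad_zero" using inf_close_sym [OF ab] by (simp add: inf_close_def)
  then obtain \<delta> where \<delta>: "0 < \<delta>" "infinitesimal \<delta>" "(1 / \<delta>) *\<^sub>H (b - a) \<in> monad_zero"
    by (rule monad_zero_rescale [OF sat_real])
  define k where "k = (1 / \<delta>) *\<^sub>H (b - a)"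
  have k: "k \<in> finite_points" "a + \<delta> *\<^sub>H k = b"
    using \<delta> by (simp_all add: k_def monad_zero_finite hyper_scaleR_inverse)
  have kh: "k + h \<in> finite_points" by (rule finite_points_add [OF k(1) h])
  have "(1 / \<delta>) *\<^sub>H (star_map f (b + \<delta> *\<^sub>H h) - star_map f b) \<sim>\<^sub>* star_map df b $* h"
    by (rule derivative [OF b h \<delta>(1,2)])
  moreover have "(1 / \<delta>) *\<^sub>H (star_map f (b + \<delta> *\<^sub>H h) - star_map f b) =
      (1 / \<delta>) *\<^sub>H (star_map f (a + \<delta> *\<^sub>H (k + h)) - star_map f a)
      - (1 / \<delta>) *\<^sub>H (star_map f (a + \<delta> *\<^sub>H k) - star_map f a)"
    by (simp add: hyper_scaleR_add_right k(2) flip: hyper_scaleR_diff_right add.assoc)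
  moreover have "\<dots> \<sim>\<^sub>* star_map df a $* (k + h) - star_map df a $* k"
    by (intro inf_close_diff derivative a k kh \<delta>)
  moreover have "star_map df a $* (k + h) - star_map df a $* k = star_map df a $* h"
    by (simp flip: star_linear_diff [OF df_linear [OF a]])
  ultimately show ?thesis by (metis inf_close_sym inf_close_trans)
qed

lemma df_inf_close:
  assumes a: "a \<in> D" and ab: "a \<sim>\<^sub>* b" and h: "h \<in> finite_points" and hk: "h \<sim>\<^sub>* k"
  shows "star_map df a $* h \<sim>\<^sub>* star_map df b $* k"
proof -
  have "star_map df a $* (h - k) \<in> monad_zero"
    using hk by (intro FLin_monad_zero sat_real df_FLin a) (simp add: inf_close_def)
  then have "star_map df a $* h \<sim>\<^sub>* star_map df a $* k"
    by (simp add: inf_close_def star_linear_diff [OF df_linear [OF a]])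
  moreover have "k \<in> finite_points" by (rule finite_points_inf_close [OF h hk])
  ultimately show ?thesis
    using df_inf_close_point [OF a ab] inf_close_sym inf_close_trans by blast
qed


section \<open>From infinitesimals to real neighbourhoods\<close>

text \<open>If the bound failed for arbitrarily small real \<open>t\<close>, saturation would yield a positive
  infinitesimal at which it fails.\<close>

lemma difference_quotient_approx:
  fixes q :: "'f \<Rightarrow> real"
  assumes a: "a \<in> D" and h: "h \<in> finite_points" and q: "continuous_seminorm q" and e: "0 < e"
  shows "\<exists>s>0. \<forall>t. 0 < t \<longrightarrow> t < s \<longrightarrow>
    star_map q ((1 / t) *\<^sub>R (star_map f (a + t *\<^sub>R h) - star_map f a) - star_map df a $* h) < star_of e"
proof (rule ccontr)
  let ?Q = "\<lambda>t. star_map q ((1 / t) *\<^sub>H (star_map f (a + t *\<^sub>H h) - star_map f a) - star_map df a $* h)"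
  assume neg: "\<not> ?thesis"
  have star_of_inverse: "1 / star_of t = (star_of (1 / t) :: ('i, real) star)" for t
    by (simp add: star_of_mk one_mk divide_mk)
  have bad: "\<exists>t. 0 < t \<and> t < s \<and> star_of e \<le> ?Q (star_of t)" if "0 < s" for s
    using neg that by (simp add: hyper_scaleR_star_of star_of_inverse not_less) (meson not_le)
  define A where "A p r = star_map2
      (\<lambda>x k. {t. 0 < t \<and> t < r \<and> e \<le> q ((1 / t) *\<^sub>R (f (x + t *\<^sub>R k) - f x) - df x k)}) a h"
    for p :: "'e \<Rightarrow> real" and r :: real
  have mem: "star_mem \<delta> (A p r) \<longleftrightarrow> 0 < \<delta> \<and> \<delta> < star_of r \<and> star_of e \<le> ?Q \<delta>" for p r \<delta>
  proof (cases a; cases h; cases \<delta>)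
    fix x k t assume x: "admissible x" "a = mk_star x" and k: "admissible k" "h = mk_star k"
      and t: "admissible t" "\<delta> = mk_star t"
    have adm: "admissible (\<lambda>i. f (x i + t i *\<^sub>R k i))" "admissible (\<lambda>i. df (x i) (k i))"
      "admissible (\<lambda>i. f (x i))" "admissible (\<lambda>i. df (x i))"
      using x k t by (simp_all add: admissible_map [of _ f] admissible_map2 [of _ _ df]
          admissible_map [of _ df])
    have adm': "admissible (\<lambda>i. q ((1 / t i) *\<^sub>R (f (x i + t i *\<^sub>R k i) - f (x i)) - df (x i) (k i)))"
      using x k t adm by (simp add: admissible_map [of _ q])
    have admA: "admissible (\<lambda>i. {t. 0 < t \<and> t < r \<and>
        e \<le> q ((1 / t) *\<^sub>R (f (x i + t *\<^sub>R k i) - f (x i)) - df (x i) (k i))})"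
      using x(1) k(1) by (rule admissible_map2)
    show ?thesis
      using x k t adm adm' admA
      by (simp add: A_def star_map_mk star_map2_mk star_mem_mk less_mk le_mk zero_mk star_of_mk
          one_mk divide_mk hyper_scaleR_mk plus_mk minus_mk star_app_mk eventually_conj_iff
          admissible_map2)
  qed
  have "\<exists>\<delta>. \<forall>p r. continuous_seminorm p \<longrightarrow> 0 < r \<longrightarrow> star_mem \<delta> (A p r)"
  proof (rule seminorm_saturation [OF sat_real])
    fix p :: "'e \<Rightarrow> real" and r :: real assume "0 < r"
    then obtain t where "0 < t" "t < r" "star_of e \<le> ?Q (star_of t)" using bad by blast
    then show "\<exists>\<delta>. star_mem \<delta> (A p r)"
      by (intro exI [of _ "star_of t"]) (simp add: mem)
  next
    fix p p' :: "'e \<Rightarrow> real" and r s :: real and \<delta>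
    assume "s \<le> r" "star_mem \<delta> (A p' s)"
    then show "star_mem \<delta> (A p r)"
      unfolding mem by (meson less_le_trans star_of_le)
  qed
  then obtain \<delta> where \<delta>: "\<And>r. 0 < r \<Longrightarrow> 0 < \<delta> \<and> \<delta> < star_of r \<and> star_of e \<le> ?Q \<delta>"
    unfolding mem using continuous_seminorm_0 by blast
  have pos: "0 < \<delta>" and far: "star_of e \<le> ?Q \<delta>" using \<delta> [OF zero_less_one] by auto
  have "infinitesimal \<delta>" using \<delta> pos by (simp add: infinitesimal_def)
  then have "infinitesimal (?Q \<delta>)"
    using derivative [OF a h pos] q by (simp add: inf_close_def monad_zero_def)
  then have "\<bar>?Q \<delta>\<bar> < star_of e" using e by (simp add: infinitesimal_def)
  with far show False by linarith
qed

text \<open>If the bound failed in every neighbourhood of \<open>(a, h)\<close>, saturation would yield a pair infinitely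
  close to \<open>(a, h)\<close> at which it fails.\<close>

lemma df_approx:
  fixes q :: "'f \<Rightarrow> real"
  assumes a: "a \<in> D" and h: "h \<in> finite_points" and q: "continuous_seminorm q" and e: "0 < e"
  shows "\<exists>p r. continuous_seminorm p \<and> 0 < r \<and> (\<forall>b k.
    star_map p (b - a) < star_of r \<longrightarrow> star_map p (k - h) < star_of r \<longrightarrow>
    star_map q (star_map df b $* k - star_map df a $* h) < star_of e)"
proof (rule ccontr)
  let ?Q = "\<lambda>b k. star_map q (star_map df b $* k - star_map df a $* h)"
  assume neg: "\<not> ?thesis"
  have bad: "\<exists>b k. star_map p (b - a) < star_of r \<and> star_map p (k - h) < star_of r \<and> star_of e \<le> ?Q b k"
    if "continuous_seminorm p" "0 < r" for p r
    using neg that by (simp add: not_less) (meson not_le)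
  define A where "A p r = star_map2
      (\<lambda>x l. {(b, k). p (b - x) < r \<and> p (k - l) < r \<and> e \<le> q (df b k - df x l)}) a h"
    for p :: "'e \<Rightarrow> real" and r :: real
  have mem: "star_mem (star_map2 Pair b k) (A p r) \<longleftrightarrow>
      star_map p (b - a) < star_of r \<and> star_map p (k - h) < star_of r \<and> star_of e \<le> ?Q b k"
    for p r b k
  proof (cases a; cases h; cases b; cases k)
    fix a' h' b' k' assume rep: "admissible a'" "a = mk_star a'" "admissible h'" "h = mk_star h'"
      "admissible b'" "b = mk_star b'" "admissible k'" "k = mk_star k'"
    have adm: "admissible (\<lambda>i. df (b' i) (k' i))" "admissible (\<lambda>i. df (a' i) (h' i))"
      "admissible (\<lambda>i. df (b' i))" "admissible (\<lambda>i. df (a' i))"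
      using rep by (simp_all add: admissible_map2 [of _ _ df] admissible_map [of _ df])
    have adm': "admissible (\<lambda>i. q (df (b' i) (k' i) - df (a' i) (h' i)))"
      "admissible (\<lambda>i. p (b' i - a' i))" "admissible (\<lambda>i. p (k' i - h' i))"
      using rep adm by (simp_all add: admissible_map [of _ q] admissible_map [of _ p])
    have admA: "admissible (\<lambda>i. {(b, k). p (b - a' i) < r \<and> p (k - h' i) < r \<and>
        e \<le> q (df b k - df (a' i) (h' i))})"
      using rep(1,3) by (rule admissible_map2)
    have admP: "admissible (\<lambda>i. (b' i, k' i))"
      using rep(5,7) by (rule admissible_map2)
    show ?thesis
      using rep adm adm' admA admP
      by (simp add: A_def star_map_mk star_map2_mk star_mem_mk less_mk le_mk star_of_mk
          minus_mk star_app_mk eventually_conj_iff admissible_map2)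
  qed
  have pair: "\<exists>b k. y = star_map2 Pair b k" for y :: "('i, 'e \<times> 'e) star"
  proof (cases y)
    case (mk z)
    then have "y = star_map2 Pair (star_map fst y) (star_map snd y)"
      by (simp add: star_map_mk star_map2_mk admissible_map)
    then show ?thesis by blast
  qed
  have "\<exists>y. \<forall>p r. continuous_seminorm p \<longrightarrow> 0 < r \<longrightarrow> star_mem y (A p r)"
  proof (rule seminorm_saturation [OF sat_pair])
    fix p :: "'e \<Rightarrow> real" and r :: real assume "continuous_seminorm p" "0 < r"
    then show "\<exists>y. star_mem y (A p r)" using bad mem by blast
  next
    fix p p' :: "'e \<Rightarrow> real" and r s :: real and y
    assume le: "\<And>x. p x \<le> p' x" "s \<le> r" and y: "star_mem y (A p' s)"
    have *: "star_map p x \<le> star_map p' x" for x :: "('i, 'e) star"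
      using le(1) by (cases x) (simp add: star_map_mk le_mk admissible_map)
    have **: "star_of s \<le> (star_of r :: ('i, real) star)" using le by simp
    obtain b k where bk: "y = star_map2 Pair b k" using pair by blast
    have "star_map p (b - a) < star_of r" "star_map p (k - h) < star_of r" "star_of e \<le> ?Q b k"
      using y * [of "b - a"] * [of "k - h"] ** unfolding bk mem by linarith+
    then show "star_mem y (A p r)" unfolding bk mem by blast
  qed
  then obtain y where y: "\<And>p r. continuous_seminorm p \<Longrightarrow> 0 < r \<Longrightarrow> star_mem y (A p r)"
    by blast
  obtain b k where "y = star_map2 Pair b k" using pair by blast
  with y have bk: "star_map p (b - a) < star_of r \<and> star_map p (k - h) < star_of r \<and> star_of e \<le> ?Q b k"
    if "continuous_seminorm p" "0 < r" for p r
    using that mem by blast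
  have "b \<sim>\<^sub>* a" "k \<sim>\<^sub>* h"
    using bk by (auto simp: inf_close_def monad_zero_def infinitesimal_def star_seminorm_nonneg)
  then have "star_map df a $* h \<sim>\<^sub>* star_map df b $* k"
    by (intro df_inf_close a h) (auto intro: inf_close_sym)
  then have "infinitesimal (?Q b k)"
    using inf_close_sym [of "star_map df a $* h"] q by (simp add: inf_close_def monad_zero_def)
  then have "\<bar>?Q b k\<bar> < star_of e" using e by (simp add: infinitesimal_def)
  moreover have "star_of e \<le> ?Q b k" using bk [OF continuous_seminorm_0 zero_less_one] by blast
  ultimately show False by linarith
qed


section \<open>The induced map and its derivative on the hull\<close>

definition hull_derivative :: "('i, 'e) ns_hull \<Rightarrow> ('i, 'e) ns_hull \<Rightarrow> ('i, 'f) ns_hull" where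
  "hull_derivative A H = hull_class (star_map df (rep_hull A) $* rep_hull H)"

lemma hull_map_class:
  assumes "a \<in> D" shows "hull_map f (hull_class a) = hull_class (star_map f a)"
  unfolding hull_map_def
  using rep_hull_class [OF D_finite [OF assms]] assms
  by (subst hull_class_eq_iff) (auto intro: f_finite D_inf_close f_inf_close inf_close_sym)

lemma hull_derivative_class:
  assumes "a \<in> D" "h \<in> finite_points"
  shows "hull_derivative (hull_class a) (hull_class h) = hull_class (star_map df a $* h)"
  unfolding hull_derivative_def
  using rep_hull_class [OF D_finite [OF assms(1)]] rep_hull_class [OF assms(2)] assms
  by (subst hull_class_eq_iff) (auto intro: df_finite D_inf_close df_inf_close inf_close_sym)

end

lemma hull_seminorm_class_le:
  assumes "continuous_seminorm p" "x \<in> finite_points" "star_map p x < star_of r"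
  shows "hull_seminorm p (hull_class x) \<le> r"
  using st_mono [of "star_map p x" "star_of r"] assms
  by (simp add: hull_seminorm_class hfinite_star_seminorm)

lemma star_seminorm_less:
  assumes "continuous_seminorm p" "x \<in> finite_points" "hull_seminorm p (hull_class x) < r"
  shows "star_map p x < star_of r"
proof (rule ccontr)
  assume "\<not> ?thesis"
  then have "r \<le> st (star_map p x)"
    using st_mono [of "star_of r" "star_map p x"] assms by (simp add: hfinite_star_seminorm)
  with assms show False by (simp add: hull_seminorm_class)
qed

text \<open>A convergence criterion with weak bounds, which are what standard parts of strict bounds give.\<close>

lemma tendsto_hullI:
  fixes L :: "('i::nonstandard_index, 'e::locally_convex_space) ns_hull"
  assumes "\<And>p e. continuous_seminorm p \<Longrightarrow> 0 < e \<Longrightarrow> \<forall>\<^sub>F x in F. hull_seminorm p (g x - L) \<le> e"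
  shows "(g \<longlongrightarrow> L) F"
  unfolding tendsto_hull_iff
proof (intro allI impI tendstoI)
  fix p :: "'e \<Rightarrow> real" and e :: real assume p: "continuous_seminorm p" and "0 < e"
  then have "\<forall>\<^sub>F x in F. hull_seminorm p (g x - L) \<le> e / 2" by (intro assms) auto
  then show "\<forall>\<^sub>F x in F. dist (hull_seminorm p (g x - L)) 0 < e"
    by eventually_elim (use p \<open>0 < e\<close> in \<open>simp add: dist_real_def\<close>)
qed

text \<open>\<open>S\<close> stands for the domain of the induced map: an open set of classes all of whose representatives
  lie in \<open>D\<close>.\<close>

locale hull_derivative_on = finite_point_derivative f df D
  for f :: "'e::locally_convex_space \<Rightarrow> 'f::locally_convex_space"
    and df :: "'e \<Rightarrow> 'e \<Rightarrow> 'f"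
    and D :: "('i::nonstandard_index, 'e) star set" +
  fixes S :: "('i, 'e) ns_hull set"
  assumes open_S: "open S"
    and class_in_S: "a \<in> finite_points \<Longrightarrow> hull_class a \<in> S \<Longrightarrow> a \<in> D"
begin

text \<open>For small \<open>t\<close> the point \<open>A + t H\<close> stays in the open set \<open>S\<close>; there the difference quotient of the
  induced map is the class of the difference quotient of \<open>f\<close> at representatives.\<close>

lemma hull_difference_quotient_right:
  assumes A: "A \<in> S"
  shows "((\<lambda>t. (1 / t) *\<^sub>R (hull_map f (A + t *\<^sub>R H) - hull_map f A)) \<longlongrightarrow> hull_derivative A H)
    (at_right 0)"
proof (rule tendsto_hullI)
  fix q :: "'f \<Rightarrow> real" and e :: real
  assume q: "continuous_seminorm q" and e: "0 < e"
  obtain a where a: "a \<in> finite_points" "A = hull_class a" by (cases A)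
  obtain h where h: "h \<in> finite_points" "H = hull_class h" by (cases H)
  have aD: "a \<in> D" using class_in_S a A by blast
  have "((\<lambda>t. A + t *\<^sub>R H) \<longlongrightarrow> A) (at_right 0)"
  proof (rule tendsto_hullI)
    fix p :: "'e \<Rightarrow> real" and e :: real
    assume p: "continuous_seminorm p" and e: "0 < e"
    have "((\<lambda>t. t * hull_seminorm p H) \<longlongrightarrow> 0 * hull_seminorm p H) (at_right (0::real))"
      by (intro tendsto_intros)
    then have "\<forall>\<^sub>F t in at_right (0::real). t * hull_seminorm p H < e"
      using e by (intro order_tendstoD(2)) auto
    moreover have "\<forall>\<^sub>F t in at_right (0::real). 0 < t" by (rule eventually_at_right_less)
    ultimately show "\<forall>\<^sub>F t in at_right 0. hull_seminorm p (A + t *\<^sub>R H - A) \<le> e"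
      by eventually_elim (simp add: hull_seminorm_scaleR [OF p])
  qed
  then have "\<forall>\<^sub>F t in at_right 0. A + t *\<^sub>R H \<in> S"
    by (rule topological_tendstoD [OF _ open_S A])
  moreover obtain s where s: "0 < s" "\<And>t. 0 < t \<Longrightarrow> t < s \<Longrightarrow>
    star_map q ((1 / t) *\<^sub>R (star_map f (a + t *\<^sub>R h) - star_map f a) - star_map df a $* h) < star_of e"
    using difference_quotient_approx [OF aD h(1) q e] by blast
  have "\<forall>\<^sub>F t in at_right (0::real). 0 < t \<and> t < s"
    using s(1) by (intro eventually_conj eventually_at_right_less)
      (auto simp: eventually_at_right_field)
  ultimately show "\<forall>\<^sub>F t in at_right 0. hull_seminorm q
      ((1 / t) *\<^sub>R (hull_map f (A + t *\<^sub>R H) - hull_map f A) - hull_derivative A H) \<le> e"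
  proof eventually_elim
    case (elim t)
    have th: "a + t *\<^sub>R h \<in> finite_points" using a h by (intro finite_points_closed)
    have cl: "A + t *\<^sub>R H = hull_class (a + t *\<^sub>R h)"
      using a h by (simp add: hull_ops finite_points_closed)
    have tD: "a + t *\<^sub>R h \<in> D" using elim(1) class_in_S th by (simp add: cl)
    let ?x = "(1 / t) *\<^sub>R (star_map f (a + t *\<^sub>R h) - star_map f a) - star_map df a $* h"
    have fin: "star_map f (a + t *\<^sub>R h) \<in> finite_points" "star_map f a \<in> finite_points"
      "star_map df a $* h \<in> finite_points"
      by (intro f_finite df_finite tD aD h)+
    have "hull_class ?x =
        (1 / t) *\<^sub>R (hull_map f (A + t *\<^sub>R H) - hull_map f A) - hull_derivative A H"
      unfolding cl using a(2) h aD tD fin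
      by (simp add: hull_map_class hull_derivative_class hull_ops finite_points_closed)
    moreover have "hull_seminorm q (hull_class ?x) \<le> e"
      using fin s(2) [of t] elim(2) by (intro hull_seminorm_class_le q finite_points_closed) auto
    ultimately show ?case by simp
  qed
qed

lemma hull_derivative_minus:
  assumes "A \<in> S" shows "hull_derivative A (- H) = - hull_derivative A H"
proof -
  obtain a where a: "a \<in> finite_points" "A = hull_class a" by (cases A)
  obtain h where h: "h \<in> finite_points" "H = hull_class h" by (cases H)
  have aD: "a \<in> D" using class_in_S a assms by blast
  have z: "star_map df a $* 0 = 0"
    using star_linear_diff [OF df_linear [OF aD], of 0 0] by simp
  show ?thesis
    using a h aD star_linear_diff [OF df_linear [OF aD], of 0 h]
    by (simp add: hull_ops hull_derivative_class finite_points_minus df_finite z)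
qed

lemma hull_difference_quotient:
  assumes A: "A \<in> S"
  shows "((\<lambda>t. (1 / t) *\<^sub>R (hull_map f (A + t *\<^sub>R H) - hull_map f A)) \<longlongrightarrow> hull_derivative A H)
    (at 0)"
proof -
  \<comment> \<open>From the left, the quotient along \<open>H\<close> is minus the quotient from the right along \<open>- H\<close>.\<close>
  have "((\<lambda>t. - ((1 / t) *\<^sub>R (hull_map f (A + t *\<^sub>R (- H)) - hull_map f A)))
      \<longlongrightarrow> - hull_derivative A (- H)) (at_right 0)"
    by (intro tendsto_minus hull_difference_quotient_right A)
  then have "((\<lambda>t. (1 / t) *\<^sub>R (hull_map f (A + t *\<^sub>R H) - hull_map f A)) \<longlongrightarrow> hull_derivative A H)
    (at_left 0)"
    by (simp add: filterlim_at_left_to_right hull_derivative_minus [OF A])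
  then show ?thesis
    using hull_difference_quotient_right [OF A] by (rule filterlim_split_at)
qed

lemma continuous_on_hull_derivative:
  "continuous_on (S \<times> UNIV) (\<lambda>(A, H). hull_derivative A H)"
  unfolding continuous_on_def
proof (intro ballI tendsto_hullI)
  fix X :: "('i, 'e) ns_hull \<times> ('i, 'e) ns_hull" and q :: "'f \<Rightarrow> real" and e :: real
  assume X: "X \<in> S \<times> UNIV" and q: "continuous_seminorm q" and e: "0 < e"
  obtain a where a: "a \<in> finite_points" "fst X = hull_class a" by (cases "fst X")
  obtain h where h: "h \<in> finite_points" "snd X = hull_class h" by (cases "snd X")
  have aD: "a \<in> D" using class_in_S a X by auto
  obtain p r where p: "continuous_seminorm p" "0 < r" and
    approx: "\<And>b k. star_map p (b - a) < star_of r \<Longrightarrow> star_map p (k - h) < star_of r \<Longrightarrow>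
      star_map q (star_map df b $* k - star_map df a $* h) < star_of e"
    using df_approx [OF aD h(1) q e] by blast
  define W where "W = {Y. hull_seminorm p (Y - fst X) < r} \<times> {Y. hull_seminorm p (Y - snd X) < r}"
  have "open W" unfolding W_def by (intro open_Times open_hull_ball p)
  moreover have "X \<in> W" using p by (cases X) (simp add: W_def)
  moreover have "hull_seminorm q ((case Y of (A, H) \<Rightarrow> hull_derivative A H)
      - (case X of (A, H) \<Rightarrow> hull_derivative A H)) \<le> e" if YW: "Y \<in> W" and YS: "Y \<in> S \<times> UNIV" for Y
  proof -
    obtain b where b: "b \<in> finite_points" "fst Y = hull_class b" by (cases "fst Y")
    obtain k where k: "k \<in> finite_points" "snd Y = hull_class k" by (cases "snd Y")
    have bD: "b \<in> D" using class_in_S b YS by auto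
    have "hull_seminorm p (hull_class (b - a)) < r" "hull_seminorm p (hull_class (k - h)) < r"
      using YW a b h k by (auto simp: W_def hull_ops)
    then have "star_map q (star_map df b $* k - star_map df a $* h) < star_of e"
      using a b h k by (intro approx star_seminorm_less p finite_points_diff)
    then have "hull_seminorm q (hull_class (star_map df b $* k - star_map df a $* h)) \<le> e"
      by (intro hull_seminorm_class_le q finite_points_diff df_finite aD bD h k)
    then show ?thesis
      using a b h k aD bD
      by (simp add: case_prod_beta hull_derivative_class hull_ops df_finite)
  qed
  ultimately show "\<forall>\<^sub>F Y in at X within S \<times> UNIV. hull_seminorm q
      ((case Y of (A, H) \<Rightarrow> hull_derivative A H) - (case X of (A, H) \<Rightarrow> hull_derivative A H)) \<le> e"
    unfolding eventually_at_topological by blast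
qed

lemma C1_on_hull_map: "C1_on S (hull_map f :: ('i, 'e) ns_hull \<Rightarrow> ('i, 'f) ns_hull)"
  unfolding C1_on_def
  using open_S hull_difference_quotient continuous_on_hull_derivative by blast

end


section \<open>The domain of the induced map\<close>

lemma open_hull_set:
  assumes "seminorm_representation I n p c \<epsilon> U"
  shows "open (hull_set I n p c \<epsilon>)"
  unfolding hull_set_def
  using assms by (intro open_UN ballI open_INT open_hull_ball) (auto simp: seminorm_representation_def)

text \<open>The finitely many strict inequalities between standard parts that put the class of \<open>x\<close> in one
  of the basic sets hold before taking standard parts.\<close>

lemma star_set_hull_set:
  fixes x :: "('i::nonstandard_index, 'e::locally_convex_space) star"
  assumes rep: "seminorm_representation I n p c \<epsilon> U"
    and x: "x \<in> finite_points" "hull_class x \<in> hull_set I n p c \<epsilon>"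
  shows "x \<in> star_set U"
proof -
  from x(2) obtain i where i: "i \<in> I" and
    *: "\<And>j. j \<in> {1..n i} \<Longrightarrow> hull_seminorm (p i j) (hull_class x - hull_class (star_of (c i j))) < \<epsilon> i j"
    by (auto simp: hull_set_def)
  obtain x' where x': "admissible x'" "x = mk_star x'" by (cases x)
  have "\<forall>\<^sub>F l in ultra. p i j (x' l - c i j) < \<epsilon> i j" if j: "j \<in> {1..n i}" for j
  proof -
    have "continuous_seminorm (p i j)" using rep i j by (auto simp: seminorm_representation_def)
    then have "star_map (p i j) (x - star_of (c i j)) < star_of (\<epsilon> i j)"
      using * [OF j] x(1) by (intro star_seminorm_less) (simp_all add: hull_ops finite_points_diff)
    then show ?thesis
      using x' by (simp add: star_of_mk minus_mk star_map_mk less_mk admissible_map [of _ "p i j"])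
  qed
  then have "\<forall>\<^sub>F l in ultra. \<forall>j\<in>{1..n i}. p i j (x' l - c i j) < \<epsilon> i j"
    by (intro eventually_ball_finite) auto
  then have "\<forall>\<^sub>F l in ultra. x' l \<in> U"
    by eventually_elim (use rep i in \<open>auto simp: seminorm_representation_def\<close>)
  then show ?thesis using x' by (simp add: star_set_mk)
qed

lemma star_interior_hull_set:
  assumes rep: "seminorm_representation I n p c \<epsilon> U"
    and x: "x \<in> finite_points" "hull_class x \<in> hull_set I n p c \<epsilon>"
  shows "x \<in> star_interior U"
proof -
  have "z \<in> star_set U" if "z \<in> monad x" for z
  proof -
    have "z \<sim>\<^sub>* x" using that by (auto simp: monad_def inf_close_def)
    then have z: "z \<in> finite_points"
      by (rule finite_points_inf_close [OF x(1) inf_close_sym])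
    then have "hull_class z = hull_class x"
      using x(1) \<open>z \<sim>\<^sub>* x\<close> by (simp add: hull_class_eq_iff)
    then show ?thesis using star_set_hull_set [OF rep z] x(2) by simp
  qed
  then show ?thesis using star_set_hull_set [OF rep x] by (auto simp: star_interior_def)
qed

theorem proposition3p10:
  fixes f :: "'e::locally_convex_space \<Rightarrow> 'f::locally_convex_space"
    and U :: "'e set"
    and I :: "'k set" and n :: "'k \<Rightarrow> nat"
    and p :: "'k \<Rightarrow> nat \<Rightarrow> 'e \<Rightarrow> real" and c :: "'k \<Rightarrow> nat \<Rightarrow> 'e" and \<epsilon> :: "'k \<Rightarrow> nat \<Rightarrow> real"
  assumes "sufficiently_saturated TYPE('i::nonstandard_index) TYPE('e) TYPE('f)"
    and "open U"
    and "seminorm_representation I n p c \<epsilon> U"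
    and "\<And>x :: ('i, 'e) star. x \<in> star_set U \<inter> finite_points \<Longrightarrow> star_map f x \<in> finite_points"
    and "uniformly_differentiable_at_finite_points TYPE('i) U f"
  shows "C1_on (hull_set I n p c \<epsilon>)
    (hull_map f :: ('i, 'e) ns_hull \<Rightarrow> ('i, 'f) ns_hull)"
proof -
  let ?D = "star_interior U \<inter> finite_points :: ('i, 'e) star set"
  obtain df :: "'e \<Rightarrow> 'e \<Rightarrow> 'f" where df: "\<And>a :: ('i, 'e) star. a \<in> ?D \<Longrightarrow>
      star_map df a \<in> FLin \<and> (\<forall>h\<in>finite_points. \<forall>\<delta>. 0 < \<delta> \<and> infinitesimal \<delta> \<longrightarrow>
        (1 / \<delta>) *\<^sub>H (star_map f (a + \<delta> *\<^sub>H h) - star_map f a) \<sim>\<^sub>* star_map df a $* h)"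
    using assms(5) unfolding uniformly_differentiable_at_finite_points_def by blast
  interpret hull_derivative_on f df ?D "hull_set I n p c \<epsilon>"
  proof
    show "saturated TYPE(('e \<Rightarrow> real) \<times> real) TYPE(('i, real) star)"
      by (rule saturated_real [OF assms(1)])
    show "saturated TYPE(('e \<Rightarrow> real) \<times> real) TYPE(('i, 'e \<times> 'e) star)"
      by (rule saturated_pair [OF assms(1)])
    show "b \<in> ?D" if "a \<in> ?D" "a \<sim>\<^sub>* b" for a b :: "('i, 'e) star"
      using that star_interior_inf_close finite_points_inf_close by blast
    show "star_map f a \<in> finite_points" if "a \<in> ?D" for a :: "('i, 'e) star"
      using that by (intro assms(4)) (simp add: star_interior_def)
    show "open (hull_set I n p c \<epsilon>)"
      by (rule open_hull_set [OF assms(3)])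
    show "a \<in> ?D" if "a \<in> finite_points" "hull_class a \<in> hull_set I n p c \<epsilon>" for a :: "('i, 'e) star"
      using that star_interior_hull_set [OF assms(3)] by blast
  qed (use df in auto)
  show ?thesis by (rule C1_on_hull_map)
qed

end
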